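(* Let $R$ be a commutative Noetherian ring with $1 \neq 0$, and let $E$ be an injective $R$-module, written as $E \cong \bigoplus_{P} \left( \bigoplus_{n_P} E(R/P) \right)$, where $P$ ranges over the prime ideals of $R$ and each $n_P$ is a cardinal number. Then $E$ is co-Hopfian if and only if $n_P$ is finite for all prime ideals $P$ of $R$.
   Context: All modules are unital. An $R$-module $M$ is co-Hopfian if every injective $R$-module endomorphism of $M$ is an isomorphism. $E(M)$ denotes the injective envelope of the $R$-module $M$, and $\bigoplus_n M$ denotes the direct sum of $n$ copies of $M$, for $n$ a cardinal number (possibly $0$). By a theorem of Matlis, every injective module $E$ over a commutative Noetherian ring $R$ has a decomposition $E \cong \bigoplus_P(\bigoplus_{n_P}E(R/P))$ over the prime ideals $P$ of $R$, and the cardinals $n_P$ characterize $E$ up to isomorphism. *)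

theory Defs
  imports "HOL-Algebra.Ring_Divisibility" "HOL-Algebra.Module"
begin

definition module_homs ::
  "('a, 'r) ring_scheme \<Rightarrow> ('a, 'm, 'c) module_scheme \<Rightarrow> ('a, 'n, 'd) module_scheme \<Rightarrow> ('m \<Rightarrow> 'n) set"
  where "module_homs R M N =
    {f \<in> carrier M \<rightarrow> carrier N.
       (\<forall>x\<in>carrier M. \<forall>y\<in>carrier M. f (x \<oplus>\<^bsub>M\<^esub> y) = f x \<oplus>\<^bsub>N\<^esub> f y) \<and>
       (\<forall>r\<in>carrier R. \<forall>x\<in>carrier M. f (r \<odot>\<^bsub>M\<^esub> x) = r \<odot>\<^bsub>N\<^esub> f x)}"

definition module_isos ::
  "('a, 'r) ring_scheme \<Rightarrow> ('a, 'm, 'c) module_scheme \<Rightarrow> ('a, 'n, 'd) module_scheme \<Rightarrow> ('m \<Rightarrow> 'n) set"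
  where "module_isos R M N = {f \<in> module_homs R M N. bij_betw f (carrier M) (carrier N)}"

definition isomorphic_modules ::
  "('a, 'r) ring_scheme \<Rightarrow> ('a, 'm, 'c) module_scheme \<Rightarrow> ('a, 'n, 'd) module_scheme \<Rightarrow> bool"
  where "isomorphic_modules R M N \<longleftrightarrow> module_isos R M N \<noteq> {}"

definition co_Hopfian :: "('a, 'r) ring_scheme \<Rightarrow> ('a, 'm, 'c) module_scheme \<Rightarrow> bool"
  where "co_Hopfian R M \<longleftrightarrow>
    (\<forall>f \<in> module_homs R M M. inj_on f (carrier M) \<longrightarrow> f \<in> module_isos R M M)"

text \<open>
  A definition cannot quantify over all types, so the modules \<open>A\<close> and \<open>B\<close> below have
  elements in the type \<open>'a\<close> of ring elements.  This is no restriction: by the lemma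
  \<open>injective_module_extend\<close> below (Baer's criterion) the extension property then holds for
  modules \<open>A\<close>, \<open>B\<close> over arbitrary element types.
\<close>

definition injective_module :: "('a, 'r) ring_scheme \<Rightarrow> ('a, 'm, 'c) module_scheme \<Rightarrow> bool"
  where "injective_module R E \<longleftrightarrow> module R E \<and>
    (\<forall>(A :: ('a, 'a) module) (B :: ('a, 'a) module) f g.
       module R A \<and> module R B \<and> f \<in> module_homs R A B \<and> inj_on f (carrier A) \<and>
       g \<in> module_homs R A E \<longrightarrow>
       (\<exists>h \<in> module_homs R B E. \<forall>x\<in>carrier A. h (f x) = g x))"

text \<open>\<open>H\<close> is an injective envelope of \<open>M\<close>: an injective module that is an essential
  extension of (an isomorphic copy of) \<open>M\<close>.\<close>

definition injective_envelope ::
  "('a, 'r) ring_scheme \<Rightarrow> ('a, 'm, 'c) module_scheme \<Rightarrow> ('a, 'h, 'd) module_scheme \<Rightarrow> bool"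
  where "injective_envelope R M H \<longleftrightarrow> injective_module R H \<and>
    (\<exists>f \<in> module_homs R M H. inj_on f (carrier M) \<and>
       (\<forall>N. submodule N R H \<and> N \<noteq> {\<zero>\<^bsub>H\<^esub>} \<longrightarrow> N \<inter> f ` carrier M \<noteq> {\<zero>\<^bsub>H\<^esub>}))"

text \<open>The fields \<open>mult\<close> and \<open>one\<close> of a module record carry no meaning.\<close>

definition quotient_module :: "('a, 'r) ring_scheme \<Rightarrow> 'a set \<Rightarrow> ('a, 'a set) module"
  where "quotient_module R I =
    \<lparr>carrier = carrier (R Quot I), mult = undefined, one = undefined,
     zero = \<zero>\<^bsub>R Quot I\<^esub>, add = add (R Quot I),
     smult = (\<lambda>r X. (I +>\<^bsub>R\<^esub> r) \<otimes>\<^bsub>R Quot I\<^esub> X)\<rparr>"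

definition direct_sum :: "'i set \<Rightarrow> ('i \<Rightarrow> ('a, 'm, 'c) module_scheme) \<Rightarrow> ('a, 'i \<Rightarrow> 'm) module"
  where "direct_sum I M =
    \<lparr>carrier = {x \<in> \<Pi>\<^sub>E i\<in>I. carrier (M i). finite {i \<in> I. x i \<noteq> \<zero>\<^bsub>M i\<^esub>}},
     mult = undefined, one = undefined,
     zero = (\<lambda>i\<in>I. \<zero>\<^bsub>M i\<^esub>), add = (\<lambda>x y. \<lambda>i\<in>I. x i \<oplus>\<^bsub>M i\<^esub> y i),
     smult = (\<lambda>r x. \<lambda>i\<in>I. r \<odot>\<^bsub>M i\<^esub> x i)\<rparr>"

text \<open>A cardinal number is represented by a cardinal order \<open>n\<close> (\<open>Card_order n\<close>);
  its field is a set of cardinality \<open>n\<close>.\<close>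

definition copies :: "'i rel \<Rightarrow> ('a, 'm, 'c) module_scheme \<Rightarrow> ('a, 'i \<Rightarrow> 'm) module"
  where "copies n M = direct_sum (Field n) (\<lambda>_. M)"


lemma module_homsD:
  assumes "f \<in> module_homs R M N"
  shows "x \<in> carrier M \<Longrightarrow> f x \<in> carrier N"
    and "x \<in> carrier M \<Longrightarrow> y \<in> carrier M \<Longrightarrow> f (x \<oplus>\<^bsub>M\<^esub> y) = f x \<oplus>\<^bsub>N\<^esub> f y"
    and "r \<in> carrier R \<Longrightarrow> x \<in> carrier M \<Longrightarrow> f (r \<odot>\<^bsub>M\<^esub> x) = r \<odot>\<^bsub>N\<^esub> f x"
  using assms by (auto simp: module_homs_def)

lemma module_homs_zero:
  assumes "module R M" "module R N" "f \<in> module_homs R M N"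
  shows "f \<zero>\<^bsub>M\<^esub> = \<zero>\<^bsub>N\<^esub>"
proof -
  interpret M: module R M by fact
  interpret N: module R N by fact
  have "f (\<zero>\<^bsub>R\<^esub> \<odot>\<^bsub>M\<^esub> \<zero>\<^bsub>M\<^esub>) = \<zero>\<^bsub>R\<^esub> \<odot>\<^bsub>N\<^esub> f \<zero>\<^bsub>M\<^esub>"
    by (rule module_homsD(3)[OF assms(3)]) auto
  thus ?thesis
    using module_homsD(1)[OF assms(3), of "\<zero>\<^bsub>M\<^esub>"] by simp
qed

lemma direct_sum_module:
  assumes "cring R" "\<And>i. i \<in> I \<Longrightarrow> module R (M i)"
  shows "module R (direct_sum I M)"
proof (rule moduleI)
  note mod [simp] = assms(2)
  have ag [simp]: "abelian_group (M i)" if "i \<in> I" for i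
    using mod[OF that] by (simp add: module_def)
  have am [simp]: "abelian_monoid (M i)" if "i \<in> I" for i
    using ag[OF that] by (simp add: abelian_group_def)
  have mz: "\<ominus>\<^bsub>M i\<^esub> \<zero>\<^bsub>M i\<^esub> = \<zero>\<^bsub>M i\<^esub>" if "i \<in> I" for i
    using abelian_group.minus_equality[OF ag[OF that], of "\<zero>\<^bsub>M i\<^esub>" "\<zero>\<^bsub>M i\<^esub>"] am[OF that]
    by (simp add: abelian_monoid.l_zero abelian_monoid.zero_closed)
  show "cring R" by fact
  show "abelian_group (direct_sum I M)"
  proof (rule abelian_groupI)
    fix x y assume x: "x \<in> carrier (direct_sum I M)" and y: "y \<in> carrier (direct_sum I M)"
    have "finite {i \<in> I. x i \<oplus>\<^bsub>M i\<^esub> y i \<noteq> \<zero>\<^bsub>M i\<^esub>}"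
      by (rule finite_subset[of _ "{i \<in> I. x i \<noteq> \<zero>\<^bsub>M i\<^esub>} \<union> {i \<in> I. y i \<noteq> \<zero>\<^bsub>M i\<^esub>}"])
         (use x y in \<open>auto simp: direct_sum_def abelian_monoid.l_zero abelian_monoid.zero_closed\<close>)
    with x y show "x \<oplus>\<^bsub>direct_sum I M\<^esub> y \<in> carrier (direct_sum I M)"
      by (auto simp: direct_sum_def PiE_iff abelian_monoid.a_closed cong: conj_cong)
  next
    show "\<zero>\<^bsub>direct_sum I M\<^esub> \<in> carrier (direct_sum I M)"
      by (auto simp: direct_sum_def abelian_monoid.zero_closed cong: conj_cong)
  next
    fix x y z assume "x \<in> carrier (direct_sum I M)" "y \<in> carrier (direct_sum I M)"
      "z \<in> carrier (direct_sum I M)"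
    thus "x \<oplus>\<^bsub>direct_sum I M\<^esub> y \<oplus>\<^bsub>direct_sum I M\<^esub> z =
      x \<oplus>\<^bsub>direct_sum I M\<^esub> (y \<oplus>\<^bsub>direct_sum I M\<^esub> z)"
      by (auto simp: direct_sum_def PiE_iff abelian_monoid.a_assoc intro!: restrict_ext)
  next
    fix x y assume "x \<in> carrier (direct_sum I M)" "y \<in> carrier (direct_sum I M)"
    thus "x \<oplus>\<^bsub>direct_sum I M\<^esub> y = y \<oplus>\<^bsub>direct_sum I M\<^esub> x"
      by (auto simp: direct_sum_def PiE_iff abelian_monoid.a_comm intro!: restrict_ext)
  next
    fix x assume "x \<in> carrier (direct_sum I M)"
    thus "\<zero>\<^bsub>direct_sum I M\<^esub> \<oplus>\<^bsub>direct_sum I M\<^esub> x = x"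
      by (auto simp: direct_sum_def PiE_iff abelian_monoid.l_zero extensional_def fun_eq_iff)
  next
    fix x assume x: "x \<in> carrier (direct_sum I M)"
    have "finite {i \<in> I. \<ominus>\<^bsub>M i\<^esub> x i \<noteq> \<zero>\<^bsub>M i\<^esub>}"
      by (rule finite_subset[of _ "{i \<in> I. x i \<noteq> \<zero>\<^bsub>M i\<^esub>}"])
         (use x in \<open>auto simp: direct_sum_def mz\<close>)
    with x show "\<exists>y\<in>carrier (direct_sum I M). y \<oplus>\<^bsub>direct_sum I M\<^esub> x = \<zero>\<^bsub>direct_sum I M\<^esub>"
      by (intro bexI[of _ "\<lambda>i\<in>I. \<ominus>\<^bsub>M i\<^esub> x i"])
         (auto simp: direct_sum_def PiE_iff abelian_group.l_neg abelian_group.a_inv_closed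
           intro!: restrict_ext cong: conj_cong)
  qed
next
  fix r x assume r: "r \<in> carrier R" and x: "x \<in> carrier (direct_sum I M)"
  have "finite {i \<in> I. r \<odot>\<^bsub>M i\<^esub> x i \<noteq> \<zero>\<^bsub>M i\<^esub>}"
    by (rule finite_subset[of _ "{i \<in> I. x i \<noteq> \<zero>\<^bsub>M i\<^esub>}"])
       (use r x in \<open>auto simp: direct_sum_def module.smult_r_null[OF assms(2)]\<close>)
  with r x show "r \<odot>\<^bsub>direct_sum I M\<^esub> x \<in> carrier (direct_sum I M)"
    by (auto simp: direct_sum_def PiE_iff module.smult_closed[OF assms(2)] cong: conj_cong)
qed (auto simp: direct_sum_def PiE_iff extensional_def fun_eq_iff
      module.smult_l_distr[OF assms(2)] module.smult_r_distr[OF assms(2)]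
      module.smult_assoc1[OF assms(2)] module.smult_one[OF assms(2)])

lemma quotient_module_module:
  assumes "cring R" "ideal I R"
  shows "module R (quotient_module R I)"
proof -
  interpret R: cring R by fact
  interpret ideal I R by fact
  interpret Q: cring "R Quot I" by (rule quotient_is_cring) fact
  interpret h: ring_hom_ring R "R Quot I" "(+>\<^bsub>R\<^esub>) I" by (rule rcos_ring_hom_ring)
  show ?thesis
  proof (rule moduleI)
    show "abelian_group (quotient_module R I)"
      by (rule abelian_groupI)
         (auto simp: quotient_module_def Q.a_ac intro: Q.l_neg bexI[of _ "\<ominus>\<^bsub>R Quot I\<^esub> _"])
    show "\<one>\<^bsub>R\<^esub> \<odot>\<^bsub>quotient_module R I\<^esub> x = x" if "x \<in> carrier (quotient_module R I)" for x
      using that h.hom_one Q.l_one[of x] by (simp add: quotient_module_def)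
  qed (auto simp: quotient_module_def assms(1) Q.l_distr Q.r_distr Q.m_assoc)
qed

lemma (in cring) ideal_module:
  assumes "ideal J R"
  shows "module R \<lparr>carrier = J, mult = undefined, one = undefined, zero = \<zero>, add = add R,
    smult = mult R\<rparr>"
proof -
  interpret ideal J R by fact
  have neg: "\<exists>y\<in>J. y \<oplus> x = \<zero>" if "x \<in> J" for x
    using that a_inv_closed[OF that] l_neg[OF a_Hcarr[OF that]] by blast
  show ?thesis
  proof (rule moduleI)
    show "abelian_group \<lparr>carrier = J, mult = undefined, one = undefined, zero = \<zero>, add = add R,
      smult = mult R\<rparr>"
      by (rule abelian_groupI) (simp_all add: neg a_assoc a_Hcarr, simp add: a_comm a_Hcarr)
  qed (simp_all add: is_cring l_distr r_distr m_assoc a_Hcarr I_l_closed)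
qed

lemma injective_module_extend:
  fixes R :: "('a, 'r) ring_scheme" and A :: "('a, 's, 'c) module_scheme"
    and B :: "('a, 't, 'd) module_scheme" and E :: "('a, 'm, 'e) module_scheme"
  assumes E: "injective_module R E" and A: "module R A" and B: "module R B"
    and f: "f \<in> module_homs R A B" and inj: "inj_on f (carrier A)"
    and g: "g \<in> module_homs R A E"
  shows "\<exists>h \<in> module_homs R B E. \<forall>x\<in>carrier A. h (f x) = g x"
proof -
  have mE: "module R E" using E by (simp add: injective_module_def)
  interpret A: module R A by fact
  interpret B: module R B by fact
  interpret E: module R E by fact
  define S where "S = {G. G \<subseteq> carrier B \<times> carrier E \<and>
    (\<forall>x y x' y'. (x, y) \<in> G \<longrightarrow> (x', y') \<in> G \<longrightarrow> (x \<oplus>\<^bsub>B\<^esub> x', y \<oplus>\<^bsub>E\<^esub> y') \<in> G) \<and>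
    (\<forall>r x y. r \<in> carrier R \<longrightarrow> (x, y) \<in> G \<longrightarrow> (r \<odot>\<^bsub>B\<^esub> x, r \<odot>\<^bsub>E\<^esub> y) \<in> G) \<and>
    (\<forall>y. (\<zero>\<^bsub>B\<^esub>, y) \<in> G \<longrightarrow> y = \<zero>\<^bsub>E\<^esub>) \<and>
    (\<forall>x\<in>carrier A. (f x, g x) \<in> G)}"
  have f0: "f \<zero>\<^bsub>A\<^esub> = \<zero>\<^bsub>B\<^esub>" and g0: "g \<zero>\<^bsub>A\<^esub> = \<zero>\<^bsub>E\<^esub>"
    using module_homs_zero A B mE f g by blast+
  have "(\<lambda>x. (f x, g x)) ` carrier A \<in> S"
  proof -
    have "g x = \<zero>\<^bsub>E\<^esub>" if "x \<in> carrier A" "f x = \<zero>\<^bsub>B\<^esub>" for x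
      using inj that f0 g0 by (metis A.zero_closed inj_onD)
    thus ?thesis
      unfolding S_def
      by (auto simp: module_homsD[OF f] module_homsD[OF g] image_iff)
         (metis A.M.a_closed module_homsD(2)[OF f] module_homsD(2)[OF g],
          metis A.smult_closed module_homsD(3)[OF f] module_homsD(3)[OF g])
  qed
  moreover have "\<Union>C \<in> S" if ne: "C \<noteq> {}" and C: "subset.chain S C" for C
  proof -
    have sub: "\<And>G. G \<in> C \<Longrightarrow> G \<in> S" and lin: "\<And>G G'. G \<in> C \<Longrightarrow> G' \<in> C \<Longrightarrow> G \<subseteq> G' \<or> G' \<subseteq> G"
      using C by (auto simp: subset_chain_def)
    have add: "(x \<oplus>\<^bsub>B\<^esub> x', y \<oplus>\<^bsub>E\<^esub> y') \<in> \<Union>C"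
      if G: "(x, y) \<in> G" "G \<in> C" and G': "(x', y') \<in> G'" "G' \<in> C" for x y x' y' G G'
    proof -
      obtain G'' where "G'' \<in> C" "(x, y) \<in> G''" "(x', y') \<in> G''"
        using lin[OF G(2) G'(2)] G G' by blast
      thus ?thesis using sub[of G''] unfolding S_def by blast
    qed
    show ?thesis
      unfolding S_def
    proof (intro CollectI conjI allI impI ballI)
      show "\<Union>C \<subseteq> carrier B \<times> carrier E" using sub unfolding S_def by blast
      show "(x \<oplus>\<^bsub>B\<^esub> x', y \<oplus>\<^bsub>E\<^esub> y') \<in> \<Union>C" if "(x, y) \<in> \<Union>C" "(x', y') \<in> \<Union>C" for x y x' y'
        using that add by blast
      show "(r \<odot>\<^bsub>B\<^esub> x, r \<odot>\<^bsub>E\<^esub> y) \<in> \<Union>C" if "r \<in> carrier R" "(x, y) \<in> \<Union>C" for r x y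
        using that sub unfolding S_def by blast
      show "y = \<zero>\<^bsub>E\<^esub>" if "(\<zero>\<^bsub>B\<^esub>, y) \<in> \<Union>C" for y
        using that sub unfolding S_def by blast
      show "(f x, g x) \<in> \<Union>C" if "x \<in> carrier A" for x
        using that sub ne unfolding S_def by blast
    qed
  qed
  ultimately obtain G where G: "G \<in> S" and max: "\<And>X. X \<in> S \<Longrightarrow> G \<subseteq> X \<Longrightarrow> X = G"
    using subset_Zorn_nonempty[of S] by blast
  have Gc: "x \<in> carrier B" "y \<in> carrier E" if "(x, y) \<in> G" for x y
    using G that unfolding S_def by auto
  have Gadd: "(x \<oplus>\<^bsub>B\<^esub> x', y \<oplus>\<^bsub>E\<^esub> y') \<in> G" if "(x, y) \<in> G" "(x', y') \<in> G" for x y x' y'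
    using G that unfolding S_def by blast
  have Gsm: "(r \<odot>\<^bsub>B\<^esub> x, r \<odot>\<^bsub>E\<^esub> y) \<in> G" if "r \<in> carrier R" "(x, y) \<in> G" for r x y
    using G that unfolding S_def by blast
  have G0: "y = \<zero>\<^bsub>E\<^esub>" if "(\<zero>\<^bsub>B\<^esub>, y) \<in> G" for y
    using G that unfolding S_def by blast
  have Gfg: "(f x, g x) \<in> G" if "x \<in> carrier A" for x
    using G that unfolding S_def by blast
  have G00: "(\<zero>\<^bsub>B\<^esub>, \<zero>\<^bsub>E\<^esub>) \<in> G" using Gfg[of "\<zero>\<^bsub>A\<^esub>"] f0 g0 by simp
  have Gneg: "(\<ominus>\<^bsub>B\<^esub> x, \<ominus>\<^bsub>E\<^esub> y) \<in> G" if "(x, y) \<in> G" for x y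
    using Gsm[OF _ that, of "\<ominus>\<^bsub>R\<^esub> \<one>\<^bsub>R\<^esub>"] Gc[OF that] by (simp add: B.smult_l_minus E.smult_l_minus)
  have Guniq: "y = y'" if "(x, y) \<in> G" "(x, y') \<in> G" for x y y'
  proof -
    have "(x \<oplus>\<^bsub>B\<^esub> \<ominus>\<^bsub>B\<^esub> x, y \<oplus>\<^bsub>E\<^esub> \<ominus>\<^bsub>E\<^esub> y') \<in> G" using Gadd[OF that(1) Gneg[OF that(2)]] .
    hence "y \<oplus>\<^bsub>E\<^esub> \<ominus>\<^bsub>E\<^esub> y' = \<zero>\<^bsub>E\<^esub>" using G0 Gc[OF that(1)] by (simp add: B.M.r_neg)
    thus ?thesis using Gc(2)[OF that(1)] Gc(2)[OF that(2)]
      by (metis E.M.minus_equality E.M.minus_minus E.M.a_inv_closed)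
  qed
  have dom: "b \<in> Domain G" if b: "b \<in> carrier B" for b
  proof -
    define J where "J = {r \<in> carrier R. r \<odot>\<^bsub>B\<^esub> b \<in> Domain G}"
    define v where "v x = (THE y. (x, y) \<in> G)" for x
    have v: "v x = y" if "(x, y) \<in> G" for x y
      unfolding v_def using that Guniq by (intro the_equality) auto
    have vG: "(x, v x) \<in> G" if "x \<in> Domain G" for x
      using that v by blast
    have Jadd: "r \<oplus>\<^bsub>R\<^esub> s \<in> J" if "r \<in> J" "s \<in> J" for r s
      using that b unfolding J_def by (auto simp: B.smult_l_distr intro: Gadd)
    have Jmul: "r \<otimes>\<^bsub>R\<^esub> s \<in> J" if "r \<in> carrier R" "s \<in> J" for r s
      using that b unfolding J_def by (auto simp: B.smult_assoc1 intro: Gsm)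
    have J0: "\<zero>\<^bsub>R\<^esub> \<in> J" using G00 b unfolding J_def by auto
    have Jc: "J \<subseteq> carrier R" by (auto simp: J_def)
    have J: "ideal J R"
    proof (rule idealI)
      show "ring R" using A by (simp add: module_def cring_def)
      show "subgroup J (add_monoid R)"
      proof (rule subgroup.intro, simp_all)
        show "J \<subseteq> carrier R" by fact
        show "\<And>x y. x \<in> J \<Longrightarrow> y \<in> J \<Longrightarrow> x \<oplus>\<^bsub>R\<^esub> y \<in> J" by fact
        show "\<zero>\<^bsub>R\<^esub> \<in> J" by fact
        fix x assume "x \<in> J"
        hence "(\<ominus>\<^bsub>R\<^esub> \<one>\<^bsub>R\<^esub>) \<otimes>\<^bsub>R\<^esub> x \<in> J" "x \<in> carrier R" using Jmul Jc by auto
        thus "inv\<^bsub>add_monoid R\<^esub> x \<in> J" by (simp add: A.R.l_minus flip: a_inv_def)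
      qed
      show "\<And>a x. a \<in> J \<Longrightarrow> x \<in> carrier R \<Longrightarrow> x \<otimes>\<^bsub>R\<^esub> a \<in> J" by (rule Jmul)
      show "\<And>a x. a \<in> J \<Longrightarrow> x \<in> carrier R \<Longrightarrow> a \<otimes>\<^bsub>R\<^esub> x \<in> J"
        using Jmul Jc by (metis A.R.m_comm subsetD)
    qed
    let ?m = "\<lambda>J. \<lparr>carrier = J, mult = undefined, one = undefined, zero = \<zero>\<^bsub>R\<^esub>, add = add R,
      smult = mult R\<rparr> :: ('a, 'a) module"
    define \<phi> where "\<phi> r = v (r \<odot>\<^bsub>B\<^esub> b)" for r
    have \<phi>G: "(r \<odot>\<^bsub>B\<^esub> b, \<phi> r) \<in> G" if "r \<in> J" for r
      using that vG by (simp add: J_def \<phi>_def)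
    have \<phi>I: "\<phi> r = y" if "(r \<odot>\<^bsub>B\<^esub> b, y) \<in> G" for r y
      using v[OF that] by (simp add: \<phi>_def)
    have "\<phi> \<in> module_homs R (?m J) E"
      unfolding module_homs_def
    proof (intro CollectI conjI ballI Pi_I, simp_all)
      show "\<phi> r \<in> carrier E" if "r \<in> J" for r using Gc \<phi>G[OF that] by blast
      show "\<phi> (r \<oplus>\<^bsub>R\<^esub> s) = \<phi> r \<oplus>\<^bsub>E\<^esub> \<phi> s" if "r \<in> J" "s \<in> J" for r s
        using that Jc b Gadd[OF \<phi>G \<phi>G, of r s] by (intro \<phi>I) (auto simp: B.smult_l_distr subset_iff)
      show "\<phi> (r \<otimes>\<^bsub>R\<^esub> s) = r \<odot>\<^bsub>E\<^esub> \<phi> s" if "r \<in> carrier R" "s \<in> J" for r s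
        using that Jc b Gsm[OF that(1) \<phi>G, of s] by (intro \<phi>I) (auto simp: B.smult_assoc1 subset_iff)
    qed
    moreover have "id \<in> module_homs R (?m J) (?m (carrier R))"
      using Jc by (auto simp: module_homs_def)
    moreover have "module R (?m J)" "module R (?m (carrier R))"
      using A.R.ideal_module J A.R.oneideal by blast+
    ultimately obtain \<psi> where \<psi>: "\<psi> \<in> module_homs R (?m (carrier R)) E"
      and \<psi>\<phi>: "\<And>r. r \<in> J \<Longrightarrow> \<psi> r = \<phi> r"
      using E unfolding injective_module_def
      by (metis (no_types, lifting) id_apply inj_on_id partial_object.select_convs(1))
    define e where "e = \<psi> \<one>\<^bsub>R\<^esub>"
    have e: "e \<in> carrier E" unfolding e_def using module_homsD(1)[OF \<psi>, of "\<one>\<^bsub>R\<^esub>"] by simp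
    have \<psi>e: "\<psi> r = r \<odot>\<^bsub>E\<^esub> e" if "r \<in> carrier R" for r
      unfolding e_def using module_homsD(3)[OF \<psi> that, of "\<one>\<^bsub>R\<^esub>"] that by simp
    define G' where "G' = {(x \<oplus>\<^bsub>B\<^esub> r \<odot>\<^bsub>B\<^esub> b, y \<oplus>\<^bsub>E\<^esub> r \<odot>\<^bsub>E\<^esub> e) | x y r. (x, y) \<in> G \<and> r \<in> carrier R}"
    have GG': "G \<subseteq> G'"
    proof
      fix p assume "p \<in> G"
      moreover obtain x y where p: "p = (x, y)" by force
      ultimately have "p = (x \<oplus>\<^bsub>B\<^esub> \<zero>\<^bsub>R\<^esub> \<odot>\<^bsub>B\<^esub> b, y \<oplus>\<^bsub>E\<^esub> \<zero>\<^bsub>R\<^esub> \<odot>\<^bsub>E\<^esub> e)" "(x, y) \<in> G"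
        using b e Gc by auto
      thus "p \<in> G'" unfolding G'_def by blast
    qed
    have "G' \<in> S"
      unfolding S_def
    proof (intro CollectI conjI allI impI ballI)
      show "G' \<subseteq> carrier B \<times> carrier E"
        using Gc b e by (auto simp: G'_def)
      show "(f x, g x) \<in> G'" if "x \<in> carrier A" for x
        using GG' Gfg[OF that] by blast
      show "(x \<oplus>\<^bsub>B\<^esub> x', y \<oplus>\<^bsub>E\<^esub> y') \<in> G'" if xy: "(x, y) \<in> G'" "(x', y') \<in> G'" for x y x' y'
      proof -
        obtain u w r where 1: "(u, w) \<in> G" "r \<in> carrier R" "x = u \<oplus>\<^bsub>B\<^esub> r \<odot>\<^bsub>B\<^esub> b" "y = w \<oplus>\<^bsub>E\<^esub> r \<odot>\<^bsub>E\<^esub> e"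
          using xy(1) unfolding G'_def by blast
        obtain u' w' r' where 2: "(u', w') \<in> G" "r' \<in> carrier R" "x' = u' \<oplus>\<^bsub>B\<^esub> r' \<odot>\<^bsub>B\<^esub> b"
          "y' = w' \<oplus>\<^bsub>E\<^esub> r' \<odot>\<^bsub>E\<^esub> e"
          using xy(2) unfolding G'_def by blast
        have "x \<oplus>\<^bsub>B\<^esub> x' = (u \<oplus>\<^bsub>B\<^esub> u') \<oplus>\<^bsub>B\<^esub> (r \<oplus>\<^bsub>R\<^esub> r') \<odot>\<^bsub>B\<^esub> b"
          using 1 2 b Gc by (simp add: B.smult_l_distr B.M.a_ac)
        moreover have "y \<oplus>\<^bsub>E\<^esub> y' = (w \<oplus>\<^bsub>E\<^esub> w') \<oplus>\<^bsub>E\<^esub> (r \<oplus>\<^bsub>R\<^esub> r') \<odot>\<^bsub>E\<^esub> e"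
          using 1 2 e Gc by (simp add: E.smult_l_distr E.M.a_ac)
        ultimately show ?thesis
          unfolding G'_def using Gadd[OF 1(1) 2(1)] 1(2) 2(2) by blast
      qed
      show "(s \<odot>\<^bsub>B\<^esub> x, s \<odot>\<^bsub>E\<^esub> y) \<in> G'" if s: "s \<in> carrier R" and xy: "(x, y) \<in> G'" for s x y
      proof -
        obtain u w r where 1: "(u, w) \<in> G" "r \<in> carrier R" "x = u \<oplus>\<^bsub>B\<^esub> r \<odot>\<^bsub>B\<^esub> b" "y = w \<oplus>\<^bsub>E\<^esub> r \<odot>\<^bsub>E\<^esub> e"
          using xy(1) unfolding G'_def by blast
        have "s \<odot>\<^bsub>B\<^esub> x = s \<odot>\<^bsub>B\<^esub> u \<oplus>\<^bsub>B\<^esub> (s \<otimes>\<^bsub>R\<^esub> r) \<odot>\<^bsub>B\<^esub> b"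
          using 1 s b Gc by (simp add: B.smult_r_distr B.smult_assoc1)
        moreover have "s \<odot>\<^bsub>E\<^esub> y = s \<odot>\<^bsub>E\<^esub> w \<oplus>\<^bsub>E\<^esub> (s \<otimes>\<^bsub>R\<^esub> r) \<odot>\<^bsub>E\<^esub> e"
          using 1 s e Gc by (simp add: E.smult_r_distr E.smult_assoc1)
        ultimately show ?thesis
          unfolding G'_def using Gsm[OF s 1(1)] 1(2) s by blast
      qed
      show "y = \<zero>\<^bsub>E\<^esub>" if xy: "(\<zero>\<^bsub>B\<^esub>, y) \<in> G'" for y
      proof -
        obtain u w r where 1: "(u, w) \<in> G" "r \<in> carrier R" "\<zero>\<^bsub>B\<^esub> = u \<oplus>\<^bsub>B\<^esub> r \<odot>\<^bsub>B\<^esub> b"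
          "y = w \<oplus>\<^bsub>E\<^esub> r \<odot>\<^bsub>E\<^esub> e"
          using xy unfolding G'_def by blast
        have u: "u \<in> carrier B" "w \<in> carrier E" using Gc 1(1) by auto
        have "r \<odot>\<^bsub>B\<^esub> b = \<ominus>\<^bsub>B\<^esub> u"
          using 1(2,3) u b by (metis B.M.a_comm B.M.minus_equality B.smult_closed)
        hence *: "(r \<odot>\<^bsub>B\<^esub> b, \<ominus>\<^bsub>E\<^esub> w) \<in> G" using Gneg[OF 1(1)] by simp
        hence "r \<in> J" using 1(2) by (auto simp: J_def)
        hence "r \<odot>\<^bsub>E\<^esub> e = \<ominus>\<^bsub>E\<^esub> w" using \<psi>e[OF 1(2)] \<psi>\<phi> \<phi>I[OF *] by simp
        thus ?thesis using 1(4) u by (simp add: E.M.r_neg)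
      qed
    qed
    hence "G' = G" using max GG' by blast
    moreover have "(\<zero>\<^bsub>B\<^esub> \<oplus>\<^bsub>B\<^esub> \<one>\<^bsub>R\<^esub> \<odot>\<^bsub>B\<^esub> b, \<zero>\<^bsub>E\<^esub> \<oplus>\<^bsub>E\<^esub> \<one>\<^bsub>R\<^esub> \<odot>\<^bsub>E\<^esub> e) \<in> G'"
      unfolding G'_def using G00 by blast
    ultimately show ?thesis using b e by auto
  qed
  hence "\<forall>x\<in>carrier B. \<exists>y. (x, y) \<in> G" by blast
  from bchoice[OF this] obtain h where h: "\<And>x. x \<in> carrier B \<Longrightarrow> (x, h x) \<in> G" by blast
  have "h \<in> module_homs R B E"
    unfolding module_homs_def
  proof (intro CollectI conjI ballI Pi_I)
    show "h x \<in> carrier E" if "x \<in> carrier B" for x using Gc h that by blast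
    show "h (x \<oplus>\<^bsub>B\<^esub> y) = h x \<oplus>\<^bsub>E\<^esub> h y" if "x \<in> carrier B" "y \<in> carrier B" for x y
      using Guniq[OF h Gadd[OF h h]] that by simp
    show "h (r \<odot>\<^bsub>B\<^esub> x) = r \<odot>\<^bsub>E\<^esub> h x" if "r \<in> carrier R" "x \<in> carrier B" for r x
      using Guniq[OF h Gsm[OF _ h]] that by simp
  qed
  moreover have "\<forall>x\<in>carrier A. h (f x) = g x"
    using Guniq[OF h Gfg] module_homsD(1)[OF f] by simp
  ultimately show ?thesis by blast
qed

end

theory Submission
  imports Defs
begin

text \<open>
  If some \<open>n P\<close> is infinite, shifting the copies of \<open>E(R/P)\<close> gives an injective endomorphism that is
  not surjective.

  Conversely, let all \<open>n P\<close> be finite and let \<open>f\<close> be an injective endomorphism of \<open>E\<close>. As \<open>E\<close> is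
  injective, \<open>f\<close> has a retraction \<open>h\<close>. If \<open>f\<close> is not surjective, then \<open>ker h \<noteq> 0\<close>, and since \<open>R\<close> is
  Noetherian, \<open>ker h\<close> contains some \<open>x\<close> whose annihilator is a prime \<open>P\<close>. The iterates \<open>f\<^sup>i(x)\<close> are
  killed by \<open>P\<close> and linearly independent over \<open>R/P\<close>. The elements of \<open>E(R/P)\<close> killed by \<open>P\<close> have
  rank one over \<open>R/P\<close>, so the \<open>n P\<close> coordinates at \<open>P\<close> can be eliminated one at a time. This leaves
  an element \<open>z\<close> with annihilator \<open>P\<close> whose coordinates at \<open>P\<close> vanish. For \<open>Q \<noteq> P\<close>, every element
  of \<open>E(R/Q)\<close> killed by \<open>P\<close> is killed by some \<open>s \<notin> P\<close>: if it is nonzero then \<open>P \<subseteq> Q\<close>, and each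
  element of \<open>Q - P\<close> has a power that kills it. So \<open>z\<close> is killed by some \<open>s \<notin> P\<close>, a contradiction.
\<close>

section \<open>Annihilators\<close>

definition annihilator :: "('a, 'r) ring_scheme \<Rightarrow> ('a, 'm, 'c) module_scheme \<Rightarrow> 'm \<Rightarrow> 'a set"
  where "annihilator R M x = {r \<in> carrier R. r \<odot>\<^bsub>M\<^esub> x = \<zero>\<^bsub>M\<^esub>}"

lemma annihilator_iff: "r \<in> annihilator R M x \<longleftrightarrow> r \<in> carrier R \<and> r \<odot>\<^bsub>M\<^esub> x = \<zero>\<^bsub>M\<^esub>"
  by (simp add: annihilator_def)

context module
begin

lemma smult_commute:
  assumes "a \<in> carrier R" "b \<in> carrier R" "x \<in> carrier M"
  shows "a \<odot>\<^bsub>M\<^esub> (b \<odot>\<^bsub>M\<^esub> x) = b \<odot>\<^bsub>M\<^esub> (a \<odot>\<^bsub>M\<^esub> x)"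
  using assms R.m_comm[of a b] by (simp flip: smult_assoc1)

lemma annihilator_ideal:
  assumes x: "x \<in> carrier M"
  shows "ideal (annihilator R M x) R"
proof (rule idealI)
  show "ring R" by (rule R.ring_axioms)
  show "subgroup (annihilator R M x) (add_monoid R)"
    by (rule subgroup.intro)
       (use x in \<open>auto simp: annihilator_def smult_l_distr smult_l_minus simp flip: a_inv_def\<close>)
  show "r \<otimes>\<^bsub>R\<^esub> a \<in> annihilator R M x" if "a \<in> annihilator R M x" "r \<in> carrier R" for a r
    using that x by (auto simp: annihilator_def smult_assoc1)
  thus "a \<otimes>\<^bsub>R\<^esub> r \<in> annihilator R M x" if "a \<in> annihilator R M x" "r \<in> carrier R" for a r
    using that by (simp add: R.m_comm[of a r] annihilator_iff)
qed

lemma annihilator_smult: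
  assumes "x \<in> carrier M" "r \<in> carrier R"
  shows "annihilator R M x \<subseteq> annihilator R M (r \<odot>\<^bsub>M\<^esub> x)"
  using assms smult_commute[of _ r x] by (auto simp: annihilator_def)

end

section \<open>Maximal ideals of a family and associated primes\<close>

text \<open>Over a Noetherian ring a nonempty chain of ideals contains its own union, so the chain
  condition of Zorn's lemma holds inside any family of ideals.\<close>

lemma (in noetherian_ring) ideal_family_has_maximal:
  assumes "S \<noteq> {}" "\<And>I. I \<in> S \<Longrightarrow> ideal I R"
  obtains I where "I \<in> S" "\<And>J. J \<in> S \<Longrightarrow> I \<subseteq> J \<Longrightarrow> J = I"
proof -
  have "\<Union>C \<in> S" if "C \<noteq> {}" "subset.chain S C" for C
  proof -
    have "subset.chain {I. ideal I R} C"
      using that(2) assms(2) unfolding subset_chain_def by blast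
    from ideal_chain_is_trivial[OF that(1) this] show ?thesis
      using that(2) unfolding subset_chain_def by blast
  qed
  with assms(1) obtain I where "I \<in> S" "\<And>J. J \<in> S \<Longrightarrow> I \<subseteq> J \<Longrightarrow> J = I"
    using subset_Zorn_nonempty[of S] by metis
  thus ?thesis by (rule that)
qed

text \<open>A maximal member of the family of annihilators of nonzero multiples of \<open>x\<close>
  is prime. Say it is the annihilator of \<open>y\<close>: if \<open>a b\<close> kills
  \<open>y\<close> but \<open>b\<close> does not, then the annihilator of \<open>b y\<close> is a
  member containing that of \<open>y\<close>, hence equal to it, and it contains
  \<open>a\<close>.\<close>

lemma (in module) associated_prime_exists:
  assumes noeth: "noetherian_ring R" and x: "x \<in> carrier M" "x \<noteq> \<zero>\<^bsub>M\<^esub>"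
  obtains r where "r \<in> carrier R" "primeideal (annihilator R M (r \<odot>\<^bsub>M\<^esub> x)) R"
proof -
  define S where "S = {annihilator R M (r \<odot>\<^bsub>M\<^esub> x) | r. r \<in> carrier R \<and> r \<odot>\<^bsub>M\<^esub> x \<noteq> \<zero>\<^bsub>M\<^esub>}"
  have "annihilator R M (\<one>\<^bsub>R\<^esub> \<odot>\<^bsub>M\<^esub> x) \<in> S"
    unfolding S_def using x smult_one[of x] by (metis (mono_tags, lifting) R.one_closed mem_Collect_eq)
  hence "S \<noteq> {}" by blast
  moreover have "ideal I R" if "I \<in> S" for I
    using that x annihilator_ideal unfolding S_def by auto
  ultimately obtain P where P: "P \<in> S" and max: "\<And>J. J \<in> S \<Longrightarrow> P \<subseteq> J \<Longrightarrow> J = P"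
    using noetherian_ring.ideal_family_has_maximal[OF noeth, of S] by metis
  from P obtain r where r: "r \<in> carrier R" "r \<odot>\<^bsub>M\<^esub> x \<noteq> \<zero>\<^bsub>M\<^esub>" "P = annihilator R M (r \<odot>\<^bsub>M\<^esub> x)"
    unfolding S_def by blast
  define y where "y = r \<odot>\<^bsub>M\<^esub> x"
  have y: "y \<in> carrier M" "y \<noteq> \<zero>\<^bsub>M\<^esub>" "P = annihilator R M y" using r x by (auto simp: y_def)
  have "primeideal P R"
  proof (rule primeidealI)
    show "ideal P R" unfolding y by (rule annihilator_ideal) (rule y)
    show "cring R" by (rule R.is_cring)
    have "\<one>\<^bsub>R\<^esub> \<notin> P" unfolding y(3) using y(1,2) by (simp add: annihilator_iff)
    thus "carrier R \<noteq> P" using R.one_closed by metis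
    fix a b assume ab: "a \<in> carrier R" "b \<in> carrier R" "a \<otimes>\<^bsub>R\<^esub> b \<in> P"
    show "a \<in> P \<or> b \<in> P"
    proof (rule disjCI)
      assume "b \<notin> P"
      hence nz: "b \<odot>\<^bsub>M\<^esub> y \<noteq> \<zero>\<^bsub>M\<^esub>" using ab y by (auto simp: annihilator_def)
      have "b \<odot>\<^bsub>M\<^esub> y = (b \<otimes>\<^bsub>R\<^esub> r) \<odot>\<^bsub>M\<^esub> x" using ab r x by (simp add: y_def smult_assoc1)
      hence "annihilator R M (b \<odot>\<^bsub>M\<^esub> y) \<in> S"
        unfolding S_def using ab r nz by (intro CollectI exI[of _ "b \<otimes>\<^bsub>R\<^esub> r"]) auto
      moreover have "P \<subseteq> annihilator R M (b \<odot>\<^bsub>M\<^esub> y)"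
        unfolding y using annihilator_smult y ab by blast
      ultimately have "annihilator R M (b \<odot>\<^bsub>M\<^esub> y) = P" by (rule max)
      moreover have "a \<in> annihilator R M (b \<odot>\<^bsub>M\<^esub> y)"
        using ab y by (auto simp: annihilator_def smult_assoc1)
      ultimately show "a \<in> P" by simp
    qed
  qed
  thus ?thesis using that r by (simp add: y_def)
qed

lemma (in primeideal) one_not_mem: "\<one> \<notin> I"
  using one_imp_carrier I_notcarr by blast

section \<open>Essential extensions of \<open>R/P\<close>\<close>

text \<open>Essentiality of \<open>H\<close> over \<open>R/P\<close> in terms of elements. The
  vector \<open>u\<close> stands for the image of the class of 1, so \<open>R u\<close> is a copy of
  \<open>R/P\<close>; the condition \<open>a \<notin> P\<close> says exactly that the common
  multiple \<open>a u\<close> is nonzero.\<close>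

locale essential_prime_extension = H?: module R H + P?: primeideal P R
  for R :: "('a, 'r) ring_scheme" and H :: "('a, 'h, 'd) module_scheme" and P +
  fixes u
  assumes u_closed: "u \<in> carrier H"
    and annihilator_u: "annihilator R H u = P"
    and essential: "\<And>y. y \<in> carrier H \<Longrightarrow> y \<noteq> \<zero>\<^bsub>H\<^esub> \<Longrightarrow>
      \<exists>r\<in>carrier R. \<exists>a\<in>carrier R - P. r \<odot>\<^bsub>H\<^esub> y = a \<odot>\<^bsub>H\<^esub> u"
begin

lemma smult_u_eq_zero_iff: "r \<in> carrier R \<Longrightarrow> r \<odot>\<^bsub>H\<^esub> u = \<zero>\<^bsub>H\<^esub> \<longleftrightarrow> r \<in> P"
  using annihilator_iff[of r R H u] annihilator_u by simp

lemma u_nonzero: "u \<noteq> \<zero>\<^bsub>H\<^esub>"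
  using smult_u_eq_zero_iff[of "\<one>\<^bsub>R\<^esub>"] smult_one[OF u_closed] P.one_not_mem R.one_closed by metis

text \<open>The annihilators of the vectors \<open>s^k y\<close> ascend with \<open>k\<close>; at a
  maximal one, \<open>z = s^k y\<close> and \<open>s z\<close> have the same annihilator. If
  \<open>z\<close> were nonzero, some \<open>r z = a u\<close> would be nonzero. But
  \<open>r s z = a s u = 0\<close> because \<open>s \<in> P\<close>, so \<open>r\<close> already
  kills \<open>z\<close>.\<close>

lemma power_kills:
  assumes noeth: "noetherian_ring R" and s: "s \<in> P" and y: "y \<in> carrier H"
  shows "\<exists>k::nat. (s [^]\<^bsub>R\<^esub> k) \<odot>\<^bsub>H\<^esub> y = \<zero>\<^bsub>H\<^esub>"
proof -
  have sR: "s \<in> carrier R" using s P.a_subset by blast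
  let ?A = "\<lambda>k::nat. annihilator R H ((s [^]\<^bsub>R\<^esub> k) \<odot>\<^bsub>H\<^esub> y)"
  have ideal_A: "ideal (?A k) R" for k by (rule annihilator_ideal) (use sR y in simp)
  have "range ?A \<noteq> {}" "\<And>I. I \<in> range ?A \<Longrightarrow> ideal I R" using ideal_A by auto
  then obtain I where I: "I \<in> range ?A" and max: "\<And>J. J \<in> range ?A \<Longrightarrow> I \<subseteq> J \<Longrightarrow> J = I"
    using noetherian_ring.ideal_family_has_maximal[OF noeth, of "range ?A"] by metis
  from I obtain k where k: "I = ?A k" by blast
  define z where "z = (s [^]\<^bsub>R\<^esub> k) \<odot>\<^bsub>H\<^esub> y"
  have z: "z \<in> carrier H" using sR y by (simp add: z_def)
  have sz: "(s [^]\<^bsub>R\<^esub> Suc k) \<odot>\<^bsub>H\<^esub> y = s \<odot>\<^bsub>H\<^esub> z"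
    using sR y by (simp add: z_def smult_assoc1 smult_commute[of _ s])
  have "I \<subseteq> ?A (Suc k)" unfolding k sz z_def[symmetric] by (rule annihilator_smult) (use z sR in auto)
  hence eq: "annihilator R H (s \<odot>\<^bsub>H\<^esub> z) = annihilator R H z"
    using max[of "?A (Suc k)"] k unfolding sz z_def[symmetric] by (metis rangeI sz z_def)
  have "z = \<zero>\<^bsub>H\<^esub>"
  proof (rule ccontr)
    assume "z \<noteq> \<zero>\<^bsub>H\<^esub>"
    then obtain r a where ra: "r \<in> carrier R" "a \<in> carrier R" "a \<notin> P" "r \<odot>\<^bsub>H\<^esub> z = a \<odot>\<^bsub>H\<^esub> u"
      using essential[OF z] by blast
    have "r \<odot>\<^bsub>H\<^esub> (s \<odot>\<^bsub>H\<^esub> z) = a \<odot>\<^bsub>H\<^esub> (s \<odot>\<^bsub>H\<^esub> u)"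
      using ra sR z u_closed by (metis smult_commute)
    also have "\<dots> = \<zero>\<^bsub>H\<^esub>" using smult_u_eq_zero_iff[OF sR] s ra by simp
    finally have "r \<in> annihilator R H z" using ra eq annihilator_iff by metis
    thus False using ra smult_u_eq_zero_iff by (simp add: annihilator_iff)
  qed
  thus ?thesis by (auto simp: z_def)
qed

text \<open>Here \<open>P\<close> is the prime of the extension and \<open>Q\<close> the prime that
  kills \<open>y\<close>. For \<open>y \<noteq> 0\<close>, a nonzero multiple \<open>a u\<close> of
  \<open>y\<close> is also killed by \<open>Q\<close>, and primality of \<open>P\<close> gives
  \<open>Q \<subseteq> P\<close>. Hence there is some \<open>s\<close> in \<open>P - Q\<close>; a
  power of it kills \<open>y\<close>, and all its powers stay outside \<open>Q\<close>.\<close>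

lemma other_prime_torsion:
  assumes noeth: "noetherian_ring R" and Q: "primeideal Q R" "Q \<noteq> P"
    and y: "y \<in> carrier H" "\<And>q. q \<in> Q \<Longrightarrow> q \<odot>\<^bsub>H\<^esub> y = \<zero>\<^bsub>H\<^esub>"
  shows "\<exists>s\<in>carrier R - Q. s \<odot>\<^bsub>H\<^esub> y = \<zero>\<^bsub>H\<^esub>"
proof (cases "y = \<zero>\<^bsub>H\<^esub>")
  interpret Q: primeideal Q R by fact
  case True
  hence "\<one>\<^bsub>R\<^esub> \<odot>\<^bsub>H\<^esub> y = \<zero>\<^bsub>H\<^esub>" using y(1) by simp
  thus ?thesis using Q.one_not_mem by blast
next
  interpret Q: primeideal Q R by fact
  case False
  then obtain r a where ra: "r \<in> carrier R" "a \<in> carrier R" "a \<notin> P" "r \<odot>\<^bsub>H\<^esub> y = a \<odot>\<^bsub>H\<^esub> u"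
    using essential[OF y(1)] by blast
  have "q \<in> P" if "q \<in> Q" for q
  proof -
    have q: "q \<in> carrier R" using that Q.a_subset by blast
    have "(q \<otimes>\<^bsub>R\<^esub> a) \<odot>\<^bsub>H\<^esub> u = q \<odot>\<^bsub>H\<^esub> (r \<odot>\<^bsub>H\<^esub> y)"
      using q ra u_closed by (simp add: smult_assoc1)
    also have "\<dots> = r \<odot>\<^bsub>H\<^esub> (q \<odot>\<^bsub>H\<^esub> y)"
      using q ra y by (intro smult_commute)
    finally have "(q \<otimes>\<^bsub>R\<^esub> a) \<odot>\<^bsub>H\<^esub> u = r \<odot>\<^bsub>H\<^esub> (q \<odot>\<^bsub>H\<^esub> y)" .
    hence "q \<otimes>\<^bsub>R\<^esub> a \<in> P" using y that q ra by (simp flip: smult_u_eq_zero_iff)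
    thus ?thesis using P.I_prime q ra by blast
  qed
  then obtain s where s: "s \<in> P" "s \<notin> Q" using Q(2) by blast
  have sR: "s \<in> carrier R" using s P.a_subset by blast
  have pow: "s [^]\<^bsub>R\<^esub> k \<notin> Q" for k :: nat
  proof (induction k)
    case 0
    show ?case using Q.one_not_mem by simp
  next
    case (Suc k)
    thus ?case using Q.I_prime[of "s [^]\<^bsub>R\<^esub> k" s] s sR by auto
  qed
  show ?thesis using power_kills[OF noeth s(1) y(1)] pow sR by blast
qed

text \<open>For nonzero \<open>z\<close>, compare both vectors with \<open>u\<close>: from
  \<open>r y = a u\<close> and \<open>r' z = a' u\<close> follows \<open>a r' z = a' r y\<close>.
  The scalar \<open>r'\<close> is outside \<open>P\<close>, since \<open>P\<close> kills
  \<open>z\<close> while \<open>a' u\<close> is nonzero; so \<open>a r'\<close> is outside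
  \<open>P\<close> as well.\<close>

lemma rank_one:
  assumes y: "y \<in> carrier H" "\<And>p. p \<in> P \<Longrightarrow> p \<odot>\<^bsub>H\<^esub> y = \<zero>\<^bsub>H\<^esub>" "y \<noteq> \<zero>\<^bsub>H\<^esub>"
    and z: "z \<in> carrier H" "\<And>p. p \<in> P \<Longrightarrow> p \<odot>\<^bsub>H\<^esub> z = \<zero>\<^bsub>H\<^esub>"
  shows "\<exists>a\<in>carrier R - P. \<exists>b\<in>carrier R. a \<odot>\<^bsub>H\<^esub> z = b \<odot>\<^bsub>H\<^esub> y"
proof (cases "z = \<zero>\<^bsub>H\<^esub>")
  case True
  hence "\<one>\<^bsub>R\<^esub> \<odot>\<^bsub>H\<^esub> z = \<zero>\<^bsub>R\<^esub> \<odot>\<^bsub>H\<^esub> y" using y(1) by simp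
  thus ?thesis using P.one_not_mem by blast
next
  case False
  obtain r a where ra: "r \<in> carrier R" "a \<in> carrier R" "a \<notin> P" "r \<odot>\<^bsub>H\<^esub> y = a \<odot>\<^bsub>H\<^esub> u"
    using essential[OF y(1,3)] by blast
  obtain r' a' where ra': "r' \<in> carrier R" "a' \<in> carrier R" "a' \<notin> P" "r' \<odot>\<^bsub>H\<^esub> z = a' \<odot>\<^bsub>H\<^esub> u"
    using essential[OF z(1) False] by blast
  have "r' \<notin> P" using z(2)[of r'] ra' smult_u_eq_zero_iff[of a'] by auto
  hence "a \<otimes>\<^bsub>R\<^esub> r' \<notin> P" using P.I_prime[of a r'] ra ra' by blast
  moreover have "(a \<otimes>\<^bsub>R\<^esub> r') \<odot>\<^bsub>H\<^esub> z = (a' \<otimes>\<^bsub>R\<^esub> r) \<odot>\<^bsub>H\<^esub> y"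
    using ra ra' y(1) z(1) smult_commute[OF ra(2) ra'(2) u_closed] by (simp add: smult_assoc1)
  ultimately show ?thesis using ra ra' by blast
qed

end

text \<open>Essentiality is tested on the cyclic submodule \<open>R y\<close>: a nonzero element
  that it shares with the image of \<open>R/P\<close> is a multiple of \<open>y\<close> and of the
  image \<open>u\<close> of the class of 1.\<close>

lemma injective_envelope_essential_prime_extension:
  fixes H :: "('a, 'h, 'd) module_scheme"
  assumes P: "primeideal P R" and env: "injective_envelope R (quotient_module R P) H"
  obtains u where "essential_prime_extension R H P u"
proof -
  interpret P: primeideal P R by fact
  let ?Q = "quotient_module R P"
  have mH: "module R H" using env by (simp add: injective_envelope_def injective_module_def)
  interpret H: module R H by fact
  have mQ: "module R ?Q" by (rule quotient_module_module) unfold_locales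
  obtain i where i: "i \<in> module_homs R ?Q H" "inj_on i (carrier ?Q)"
    and ess: "\<And>N. submodule N R H \<Longrightarrow> N \<noteq> {\<zero>\<^bsub>H\<^esub>} \<Longrightarrow> N \<inter> i ` carrier ?Q \<noteq> {\<zero>\<^bsub>H\<^esub>}"
    using env unfolding injective_envelope_def by blast
  define u where "u = i (P +>\<^bsub>R\<^esub> \<one>\<^bsub>R\<^esub>)"
  have cQ: "P +>\<^bsub>R\<^esub> a \<in> carrier ?Q" if "a \<in> carrier R" for a
    using that by (auto simp: quotient_module_def FactRing_simps)
  have au: "a \<odot>\<^bsub>H\<^esub> u = i (P +>\<^bsub>R\<^esub> a)" if a: "a \<in> carrier R" for a
  proof -
    have "a \<odot>\<^bsub>H\<^esub> u = i (a \<odot>\<^bsub>?Q\<^esub> (P +>\<^bsub>R\<^esub> \<one>\<^bsub>R\<^esub>))"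
      unfolding u_def using module_homsD(3)[OF i(1) a cQ] by simp
    also have "a \<odot>\<^bsub>?Q\<^esub> (P +>\<^bsub>R\<^esub> \<one>\<^bsub>R\<^esub>) = P +>\<^bsub>R\<^esub> a"
      using a by (simp add: quotient_module_def FactRing_def P.rcoset_mult_add)
    finally show ?thesis .
  qed
  \<comment> \<open>The zero element of \<open>R/P\<close> is the coset \<open>P\<close>
    itself.\<close>
  have i0: "i P = \<zero>\<^bsub>H\<^esub>"
    using module_homs_zero[OF mQ mH i(1)] by (simp add: quotient_module_def FactRing_def)
  have PQ: "P \<in> carrier ?Q"
    using cQ[of "\<zero>\<^bsub>R\<^esub>"] P.a_rcos_zero[OF P.ideal_axioms, of "\<zero>\<^bsub>R\<^esub>"] by simp
  have au0: "a \<odot>\<^bsub>H\<^esub> u = \<zero>\<^bsub>H\<^esub> \<longleftrightarrow> a \<in> P" if a: "a \<in> carrier R" for a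
  proof -
    have "a \<odot>\<^bsub>H\<^esub> u = \<zero>\<^bsub>H\<^esub> \<longleftrightarrow> P +>\<^bsub>R\<^esub> a = P"
      unfolding au[OF a] using inj_onD[OF i(2) _ cQ[OF a] PQ] i0 by auto
    also have "\<dots> \<longleftrightarrow> a \<in> P"
      using P.rcos_const_imp_mem[OF a] P.a_rcos_zero[OF P.ideal_axioms] by blast
    finally show ?thesis .
  qed
  have "essential_prime_extension R H P u"
  proof unfold_locales
    show u: "u \<in> carrier H" unfolding u_def using module_homsD(1)[OF i(1) cQ] by simp
    show "annihilator R H u = P" using au0 P.a_subset by (auto simp: annihilator_def)
    fix y assume y: "y \<in> carrier H" "y \<noteq> \<zero>\<^bsub>H\<^esub>"
    let ?N = "(\<lambda>r. r \<odot>\<^bsub>H\<^esub> y) ` carrier R"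
    have N: "submodule ?N R H"
    proof (rule H.submoduleI)
      show "?N \<subseteq> carrier H" using y by auto
      show "\<zero>\<^bsub>H\<^esub> \<in> ?N" using y by (intro image_eqI[of _ _ "\<zero>\<^bsub>R\<^esub>"]) auto
      show "\<ominus>\<^bsub>H\<^esub> a \<in> ?N" if "a \<in> ?N" for a
        using that y by (auto simp flip: H.smult_l_minus)
      show "a \<oplus>\<^bsub>H\<^esub> b \<in> ?N" if "a \<in> ?N" "b \<in> ?N" for a b
        using that y by (auto simp flip: H.smult_l_distr)
      show "a \<odot>\<^bsub>H\<^esub> x \<in> ?N" if "a \<in> carrier R" "x \<in> ?N" for a x
        using that y by (auto simp flip: H.smult_assoc1)
    qed
    have "y \<in> ?N" using y by (intro image_eqI[of _ _ "\<one>\<^bsub>R\<^esub>"]) auto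
    hence "?N \<inter> i ` carrier ?Q \<noteq> {\<zero>\<^bsub>H\<^esub>}" using y by (intro ess[OF N]) auto
    moreover have "\<zero>\<^bsub>H\<^esub> \<in> ?N \<inter> i ` carrier ?Q"
      using i0 PQ H.submoduleE(2)[OF N] y by (auto intro: image_eqI[of _ _ "\<zero>\<^bsub>R\<^esub>"] image_eqI[of _ i P])
    ultimately obtain w where w: "w \<in> ?N" "w \<in> i ` carrier ?Q" "w \<noteq> \<zero>\<^bsub>H\<^esub>" by blast
    from w(2) obtain a where a: "a \<in> carrier R" "w = i (P +>\<^bsub>R\<^esub> a)"
      by (auto simp: quotient_module_def FactRing_simps)
    from w(1) obtain r where r: "r \<in> carrier R" "w = r \<odot>\<^bsub>H\<^esub> y" by blast
    have "w = a \<odot>\<^bsub>H\<^esub> u" using a au by simp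
    moreover from this have "a \<notin> P" using au0[OF a(1)] w(3) by simp
    ultimately show "\<exists>r\<in>carrier R. \<exists>a\<in>carrier R - P. r \<odot>\<^bsub>H\<^esub> y = a \<odot>\<^bsub>H\<^esub> u"
      using a(1) r by auto
  qed
  thus ?thesis by (rule that)
qed

section \<open>Elimination of coordinates\<close>

context module
begin

text \<open>
  The classes of the \<open>y i\<close> in \<open>F i / F (i + 1)\<close> have annihilator exactly \<open>P\<close>. Hence the \<open>y i\<close> are
  linearly independent over \<open>R/P\<close>; the filtration \<open>F\<close> replaces finite linear combinations.
\<close>

definition independent_along :: "'a set \<Rightarrow> (nat \<Rightarrow> 'c set) \<Rightarrow> (nat \<Rightarrow> 'c) \<Rightarrow> bool"
  where "independent_along P F y \<longleftrightarrow>
    (\<forall>i. submodule (F i) R M \<and> F (Suc i) \<subseteq> F i \<and> y i \<in> F i \<and>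
       (\<forall>p\<in>P. p \<odot>\<^bsub>M\<^esub> y i = \<zero>\<^bsub>M\<^esub>) \<and> (\<forall>r\<in>carrier R. r \<odot>\<^bsub>M\<^esub> y i \<in> F (Suc i) \<longrightarrow> r \<in> P))"

lemma submodule_zero_mem: "submodule A R M \<Longrightarrow> \<zero>\<^bsub>M\<^esub> \<in> A"
  using subgroup.one_closed[OF submodule.axioms(1)] by fastforce

lemma submodule_inter:
  assumes "submodule A R M" "submodule B R M"
  shows "submodule (A \<inter> B) R M"
  using submoduleE[OF assms(1)] submoduleE[OF assms(2)] submodule_zero_mem[OF assms(1)]
    submodule_zero_mem[OF assms(2)]
  by (intro submoduleI) auto

text \<open>This is \<open>A + R x\<close>, the form in which a pivot \<open>x\<close> is adjoined
  to a member \<open>A\<close> of the filtration.\<close>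

lemma submodule_plus_span:
  assumes A: "submodule A R M" and x: "x \<in> carrier M"
  shows "submodule {w \<oplus>\<^bsub>M\<^esub> b \<odot>\<^bsub>M\<^esub> x | w b. w \<in> A \<and> b \<in> carrier R} R M" (is "submodule ?B R M")
proof (rule submoduleI)
  note A' = submoduleE[OF A]
  have I: "w \<oplus>\<^bsub>M\<^esub> b \<odot>\<^bsub>M\<^esub> x \<in> ?B" if "w \<in> A" "b \<in> carrier R" for w b using that by blast
  show "?B \<subseteq> carrier M" using A' x by auto
  show "\<zero>\<^bsub>M\<^esub> \<in> ?B" using I[OF submodule_zero_mem[OF A], of "\<zero>\<^bsub>R\<^esub>"] x by simp
  show smult: "a \<odot>\<^bsub>M\<^esub> v \<in> ?B" if "a \<in> carrier R" "v \<in> ?B" for a v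
  proof -
    from that(2) obtain w b where wb: "v = w \<oplus>\<^bsub>M\<^esub> b \<odot>\<^bsub>M\<^esub> x" "w \<in> A" "b \<in> carrier R" by blast
    have "w \<in> carrier M" using wb A' by blast
    hence "a \<odot>\<^bsub>M\<^esub> v = a \<odot>\<^bsub>M\<^esub> w \<oplus>\<^bsub>M\<^esub> (a \<otimes>\<^bsub>R\<^esub> b) \<odot>\<^bsub>M\<^esub> x"
      using wb that(1) x by (simp add: smult_r_distr smult_assoc1)
    thus ?thesis using I[of "a \<odot>\<^bsub>M\<^esub> w" "a \<otimes>\<^bsub>R\<^esub> b"] that(1) wb A' by simp
  qed
  show "\<ominus>\<^bsub>M\<^esub> v \<in> ?B" if "v \<in> ?B" for v
  proof -
    have "v \<in> carrier M" using that A' x by auto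
    thus ?thesis using smult[OF _ that, of "\<ominus>\<^bsub>R\<^esub> \<one>\<^bsub>R\<^esub>"] by (simp add: smult_l_minus)
  qed
  show "v \<oplus>\<^bsub>M\<^esub> v' \<in> ?B" if "v \<in> ?B" "v' \<in> ?B" for v v'
  proof -
    from that(1) obtain w b where wb: "v = w \<oplus>\<^bsub>M\<^esub> b \<odot>\<^bsub>M\<^esub> x" "w \<in> A" "b \<in> carrier R" by blast
    from that(2) obtain w' b' where wb': "v' = w' \<oplus>\<^bsub>M\<^esub> b' \<odot>\<^bsub>M\<^esub> x" "w' \<in> A" "b' \<in> carrier R" by blast
    have "w \<in> carrier M" "w' \<in> carrier M" using wb wb' A' by blast+
    hence "v \<oplus>\<^bsub>M\<^esub> v' = (w \<oplus>\<^bsub>M\<^esub> w') \<oplus>\<^bsub>M\<^esub> (b \<oplus>\<^bsub>R\<^esub> b') \<odot>\<^bsub>M\<^esub> x"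
      using wb wb' x by (simp add: smult_l_distr M.a_ac)
    thus ?thesis using I[of "w \<oplus>\<^bsub>M\<^esub> w'" "b \<oplus>\<^bsub>R\<^esub> b'"] wb wb' A' by simp
  qed
qed

lemma kernel_submodule:
  assumes N: "module R N" and c: "c \<in> module_homs R M N"
  shows "submodule {x \<in> carrier M. c x = \<zero>\<^bsub>N\<^esub>} R M"
proof -
  interpret N: module R N by fact
  have c0: "c \<zero>\<^bsub>M\<^esub> = \<zero>\<^bsub>N\<^esub>" by (rule module_homs_zero[OF module_axioms N c])
  have neg: "c (\<ominus>\<^bsub>M\<^esub> x) = \<zero>\<^bsub>N\<^esub>" if "x \<in> carrier M" "c x = \<zero>\<^bsub>N\<^esub>" for x
    using module_homsD(3)[OF c, of "\<ominus>\<^bsub>R\<^esub> \<one>\<^bsub>R\<^esub>" x] that by (simp add: smult_l_minus)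
  show ?thesis
    by (rule submoduleI) (use c0 neg in \<open>auto simp: module_homsD[OF c]\<close>)
qed

text \<open>
  Gaussian elimination: if \<open>c (y k) \<noteq> 0\<close>, then \<open>y k\<close> is the pivot; adjoining it to
  the later members of the filtration keeps the reduced vectors independent.
\<close>

lemma eliminate_coordinate:
  assumes P: "primeideal P R" and N: "module R N" and c: "c \<in> module_homs R M N"
    and rank: "\<And>v w. v \<in> carrier N \<Longrightarrow> (\<And>p. p \<in> P \<Longrightarrow> p \<odot>\<^bsub>N\<^esub> v = \<zero>\<^bsub>N\<^esub>) \<Longrightarrow> v \<noteq> \<zero>\<^bsub>N\<^esub> \<Longrightarrow>
      w \<in> carrier N \<Longrightarrow> (\<And>p. p \<in> P \<Longrightarrow> p \<odot>\<^bsub>N\<^esub> w = \<zero>\<^bsub>N\<^esub>) \<Longrightarrow>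
      \<exists>a\<in>carrier R - P. \<exists>b\<in>carrier R. a \<odot>\<^bsub>N\<^esub> w = b \<odot>\<^bsub>N\<^esub> v"
    and ind: "independent_along P F y"
  obtains F' y' where "independent_along P F' y'" "F' 0 \<subseteq> F 0 \<inter> {x \<in> carrier M. c x = \<zero>\<^bsub>N\<^esub>}"
proof -
  interpret P: primeideal P R by fact
  interpret N: module R N by fact
  let ?K = "{x \<in> carrier M. c x = \<zero>\<^bsub>N\<^esub>}"
  have K: "submodule ?K R M" by (rule kernel_submodule[OF N c])
  have Fs: "submodule (F i) R M" and Fd: "F (Suc i) \<subseteq> F i" and Fy: "y i \<in> F i"
    and Py: "\<And>p. p \<in> P \<Longrightarrow> p \<odot>\<^bsub>M\<^esub> y i = \<zero>\<^bsub>M\<^esub>"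
    and Fi: "\<And>r. r \<in> carrier R \<Longrightarrow> r \<odot>\<^bsub>M\<^esub> y i \<in> F (Suc i) \<Longrightarrow> r \<in> P" for i
    using ind unfolding independent_along_def by blast+
  note FE = submoduleE[OF Fs]
  have yc: "y i \<in> carrier M" for i using Fy FE(1) by blast
  have Pc: "p \<in> carrier R" if "p \<in> P" for p using that P.a_subset by blast
  have c0: "c \<zero>\<^bsub>M\<^esub> = \<zero>\<^bsub>N\<^esub>" by (rule module_homs_zero[OF module_axioms N c])
  have Pcy: "p \<odot>\<^bsub>N\<^esub> c (y i) = \<zero>\<^bsub>N\<^esub>" if "p \<in> P" for p i
    using module_homsD(3)[OF c Pc[OF that] yc, of i] Py[OF that] c0 by simp
  show ?thesis
  proof (cases "\<exists>k. c (y k) \<noteq> \<zero>\<^bsub>N\<^esub>")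
    case False
    \<comment> \<open>When \<open>c\<close> vanishes on every \<open>y i\<close>, the vectors
      survive the intersection with the kernel, and independence persists because a multiple in the
      smaller set also lies in \<open>F (Suc i)\<close>.\<close>
    have "independent_along P (\<lambda>i. F i \<inter> ?K) y"
      unfolding independent_along_def
      using Fs Fd Fy Py Fi yc False submodule_inter[OF Fs K] by blast
    thus ?thesis by (rule that) blast
  next
    case True
    then obtain k where k: "c (y k) \<noteq> \<zero>\<^bsub>N\<^esub>" by blast
    have "\<exists>a b. a \<in> carrier R - P \<and> b \<in> carrier R \<and> a \<odot>\<^bsub>N\<^esub> c (y (Suc k + i)) = b \<odot>\<^bsub>N\<^esub> c (y k)" for i
      using rank[OF _ _ k, of "c (y (Suc k + i))"] module_homsD(1)[OF c yc] Pcy by blast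
    \<comment> \<open>The coordinate of each later vector is the fraction \<open>b i / a i\<close>
      of the pivot coordinate, with denominator outside \<open>P\<close>.\<close>
    then obtain a b where a: "\<And>i. a i \<in> carrier R" "\<And>i. a i \<notin> P" and b: "\<And>i. b i \<in> carrier R"
      and ab: "\<And>i. a i \<odot>\<^bsub>N\<^esub> c (y (Suc k + i)) = b i \<odot>\<^bsub>N\<^esub> c (y k)"
      by (metis DiffE)
    \<comment> \<open>The vectors up to and including the pivot are dropped, hence the shift by
      \<open>Suc k\<close>. The reduced vector \<open>y' i\<close> involves \<open>y k\<close>, so
      every \<open>G i\<close> must contain the multiples of \<open>y k\<close>.\<close>
    define G where "G i = {w \<oplus>\<^bsub>M\<^esub> s \<odot>\<^bsub>M\<^esub> y k | w s. w \<in> F (Suc k + i) \<and> s \<in> carrier R}" for i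
    define y' where "y' i = a i \<odot>\<^bsub>M\<^esub> y (Suc k + i) \<oplus>\<^bsub>M\<^esub> (\<ominus>\<^bsub>R\<^esub> b i) \<odot>\<^bsub>M\<^esub> y k" for i
    have antimono: "F j \<subseteq> F i" if "i \<le> j" for i j
      using lift_Suc_antimono_le[of F, OF Fd that] .
    have y'K: "y' i \<in> ?K" for i
    proof -
      have "c (y' i) = a i \<odot>\<^bsub>N\<^esub> c (y (Suc k + i)) \<oplus>\<^bsub>N\<^esub> (\<ominus>\<^bsub>R\<^esub> b i) \<odot>\<^bsub>N\<^esub> c (y k)"
        unfolding y'_def using a b yc by (simp add: module_homsD[OF c])
      also have "\<dots> = \<zero>\<^bsub>N\<^esub>"
        unfolding ab using b module_homsD(1)[OF c yc] by (simp add: N.smult_l_minus N.M.r_neg)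
      finally show ?thesis using a b yc by (simp add: y'_def)
    qed
    have "independent_along P (\<lambda>i. G i \<inter> ?K) y'"
      unfolding independent_along_def
    proof (intro allI conjI ballI impI)
      fix i
      show "submodule (G i \<inter> ?K) R M"
        unfolding G_def by (intro submodule_inter submodule_plus_span Fs K yc)
      show "G (Suc i) \<inter> ?K \<subseteq> G i \<inter> ?K"
        unfolding G_def using Fd[of "Suc k + i"] by auto
      show "y' i \<in> G i \<inter> ?K"
        using y'K FE(4)[OF a(1) Fy] b unfolding G_def y'_def by blast
      show "p \<odot>\<^bsub>M\<^esub> y' i = \<zero>\<^bsub>M\<^esub>" if "p \<in> P" for p
        using that a b yc Pc Py
        by (simp add: y'_def smult_r_distr smult_commute[of p])
      fix r assume r: "r \<in> carrier R" and "r \<odot>\<^bsub>M\<^esub> y' i \<in> G (Suc i) \<inter> ?K"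
      then obtain w s where w: "w \<in> F (Suc (Suc k + i))" and s: "s \<in> carrier R"
        and eq: "r \<odot>\<^bsub>M\<^esub> y' i = w \<oplus>\<^bsub>M\<^esub> s \<odot>\<^bsub>M\<^esub> y k"
        unfolding G_def by auto
      have wc: "w \<in> carrier M" using w FE(1) by blast
      \<comment> \<open>Clearing \<open>b i\<close> from \<open>y' i\<close> gives
        \<open>r a_i y_{k+1+i} = w + t y_k\<close>. All terms but the last lie in
        \<open>F (Suc k)\<close>, so independence at \<open>k\<close> forces
        \<open>t \<in> P\<close> and the last term vanishes. Independence at
        \<open>Suc k + i\<close> then puts \<open>r a_i\<close> into \<open>P\<close>, and
        \<open>a i\<close> is outside it.\<close>
      define t where "t = s \<oplus>\<^bsub>R\<^esub> r \<otimes>\<^bsub>R\<^esub> b i"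
      have t: "t \<in> carrier R" using s r b by (simp add: t_def)
      have "(r \<otimes>\<^bsub>R\<^esub> a i) \<odot>\<^bsub>M\<^esub> y (Suc k + i) = r \<odot>\<^bsub>M\<^esub> y' i \<oplus>\<^bsub>M\<^esub> (r \<otimes>\<^bsub>R\<^esub> b i) \<odot>\<^bsub>M\<^esub> y k"
        using r a b yc
        by (simp add: y'_def smult_r_distr smult_assoc1 smult_l_minus smult_r_minus M.a_assoc M.l_neg)
      also have "\<dots> = w \<oplus>\<^bsub>M\<^esub> t \<odot>\<^bsub>M\<^esub> y k"
        unfolding eq t_def using wc r s b yc by (simp add: smult_l_distr M.a_assoc)
      finally have eq': "(r \<otimes>\<^bsub>R\<^esub> a i) \<odot>\<^bsub>M\<^esub> y (Suc k + i) = w \<oplus>\<^bsub>M\<^esub> t \<odot>\<^bsub>M\<^esub> y k" .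
      have "t \<odot>\<^bsub>M\<^esub> y k = (r \<otimes>\<^bsub>R\<^esub> a i) \<odot>\<^bsub>M\<^esub> y (Suc k + i) \<oplus>\<^bsub>M\<^esub> \<ominus>\<^bsub>M\<^esub> w"
        unfolding eq' using wc t yc by (simp add: M.a_assoc M.a_comm[of _ "\<ominus>\<^bsub>M\<^esub> w"] M.r_neg1 M.r_neg2)
      moreover have "(r \<otimes>\<^bsub>R\<^esub> a i) \<odot>\<^bsub>M\<^esub> y (Suc k + i) \<in> F (Suc k)"
        using FE(4)[OF _ Fy, of "r \<otimes>\<^bsub>R\<^esub> a i" "Suc k + i"] antimono[of "Suc k" "Suc k + i"] r a by auto
      moreover have "\<ominus>\<^bsub>M\<^esub> w \<in> F (Suc k)"
        using FE(3)[OF w] antimono[of "Suc k" "Suc (Suc k + i)"] by auto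
      ultimately have "t \<odot>\<^bsub>M\<^esub> y k \<in> F (Suc k)" using FE(5) by simp
      hence "t \<in> P" using Fi t by blast
      hence "(r \<otimes>\<^bsub>R\<^esub> a i) \<odot>\<^bsub>M\<^esub> y (Suc k + i) = w" unfolding eq' using Py wc by simp
      hence "r \<otimes>\<^bsub>R\<^esub> a i \<in> P" using Fi[of "r \<otimes>\<^bsub>R\<^esub> a i" "Suc k + i"] w r a by simp
      thus "r \<in> P" using P.I_prime[OF r a(1)] a(2) by blast
    qed
    moreover have "G 0 \<subseteq> F 0"
    proof
      fix v assume "v \<in> G 0"
      then obtain w s where "w \<in> F (Suc k)" "s \<in> carrier R" "v = w \<oplus>\<^bsub>M\<^esub> s \<odot>\<^bsub>M\<^esub> y k"
        unfolding G_def by auto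
      thus "v \<in> F 0"
        using submoduleE(4,5)[OF Fs[of 0]] Fy[of k] antimono[of 0 k] antimono[of 0 "Suc k"] by (simp add: subset_iff)
    qed
    ultimately show ?thesis using that[of "\<lambda>i. G i \<inter> ?K" y'] by blast
  qed
qed

text \<open>Induction over \<open>J\<close> with the stronger invariant that the treated coordinates
  vanish on all of \<open>F' 0\<close>; each elimination only shrinks this set. At the end
  \<open>z\<close> is \<open>y' 0\<close>: a scalar killing it sends it to 0, which lies in
  \<open>F' (Suc 0)\<close>, so the scalar is in \<open>P\<close>.\<close>

lemma eliminate_coordinates:
  assumes P: "primeideal P R" and N: "module R N" and J: "finite J"
    and c: "\<And>j. j \<in> J \<Longrightarrow> c j \<in> module_homs R M N"
    and rank: "\<And>v w. v \<in> carrier N \<Longrightarrow> (\<And>p. p \<in> P \<Longrightarrow> p \<odot>\<^bsub>N\<^esub> v = \<zero>\<^bsub>N\<^esub>) \<Longrightarrow> v \<noteq> \<zero>\<^bsub>N\<^esub> \<Longrightarrow>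
      w \<in> carrier N \<Longrightarrow> (\<And>p. p \<in> P \<Longrightarrow> p \<odot>\<^bsub>N\<^esub> w = \<zero>\<^bsub>N\<^esub>) \<Longrightarrow>
      \<exists>a\<in>carrier R - P. \<exists>b\<in>carrier R. a \<odot>\<^bsub>N\<^esub> w = b \<odot>\<^bsub>N\<^esub> v"
    and ind: "independent_along P F y"
  obtains z where "z \<in> carrier M" "annihilator R M z = P" "\<And>j. j \<in> J \<Longrightarrow> c j z = \<zero>\<^bsub>N\<^esub>"
proof -
  have "\<exists>F' y'. independent_along P F' y' \<and> (\<forall>j\<in>J. \<forall>x\<in>F' 0. c j x = \<zero>\<^bsub>N\<^esub>)"
    using J c
  proof (induction J)
    case empty
    thus ?case using ind by blast
  next
    case (insert j J)
    then obtain F1 y1 where 1: "independent_along P F1 y1" "\<forall>j\<in>J. \<forall>x\<in>F1 0. c j x = \<zero>\<^bsub>N\<^esub>"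
      by auto
    have "c j \<in> module_homs R M N" using insert.prems by blast
    from eliminate_coordinate[OF P N this rank 1(1)]
    obtain F2 y2 where "independent_along P F2 y2" "F2 0 \<subseteq> F1 0 \<inter> {x \<in> carrier M. c j x = \<zero>\<^bsub>N\<^esub>}"
      by blast
    thus ?case using 1(2) by blast
  qed
  then obtain F' y' where F': "independent_along P F' y'" "\<forall>j\<in>J. \<forall>x\<in>F' 0. c j x = \<zero>\<^bsub>N\<^esub>" by blast
  have *: "submodule (F' 0) R M" "submodule (F' (Suc 0)) R M" "y' 0 \<in> F' 0"
    "\<forall>p\<in>P. p \<odot>\<^bsub>M\<^esub> y' 0 = \<zero>\<^bsub>M\<^esub>" "\<forall>r\<in>carrier R. r \<odot>\<^bsub>M\<^esub> y' 0 \<in> F' (Suc 0) \<longrightarrow> r \<in> P"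
    using F'(1) unfolding independent_along_def by blast+
  have sub: "P \<subseteq> carrier R"
    using P by (intro additive_subgroup.a_subset ideal.axioms(1) primeideal.axioms(1))
  have "r \<in> P" if "r \<in> annihilator R M (y' 0)" for r
    using that * submodule_zero_mem[OF *(2)] by (metis annihilator_iff)
  hence "annihilator R M (y' 0) = P" using *(4) sub by (auto simp: annihilator_iff)
  moreover have "y' 0 \<in> carrier M" using *(1,3) submoduleE(1) by blast
  ultimately show ?thesis using that F'(2) *(3) by blast
qed

text \<open>If \<open>r f^i(x) = f^{i+1}(v)\<close>, injectivity of \<open>f^i\<close> cancels the
  power and leaves \<open>r x = f v\<close>; so every index reduces to the hypothesis
  \<open>indep\<close>.\<close>

lemma independent_along_iterates:
  assumes f: "f \<in> module_homs R M M" and inj: "inj_on f (carrier M)"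
    and x: "x \<in> carrier M" "\<And>p. p \<in> P \<Longrightarrow> p \<odot>\<^bsub>M\<^esub> x = \<zero>\<^bsub>M\<^esub>" and P: "P \<subseteq> carrier R"
    and indep: "\<And>r. r \<in> carrier R \<Longrightarrow> r \<odot>\<^bsub>M\<^esub> x \<in> f ` carrier M \<Longrightarrow> r \<in> P"
  shows "independent_along P (\<lambda>i. (f ^^ i) ` carrier M) (\<lambda>i. (f ^^ i) x)"
proof -
  have fi: "f ^^ i \<in> module_homs R M M" for i
    by (induction i) (auto simp: module_homs_def module_homsD[OF f] Pi_iff)
  have fi_inj: "inj_on (f ^^ i) (carrier M)" for i
  proof (induction i)
    case (Suc i)
    have "inj_on f ((f ^^ i) ` carrier M)"
      using inj module_homsD(1)[OF fi] by (blast intro: inj_on_subset)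
    from comp_inj_on[OF Suc this] show ?case by (simp add: comp_def)
  qed (simp add: inj_on_def)
  have f0: "(f ^^ i) \<zero>\<^bsub>M\<^esub> = \<zero>\<^bsub>M\<^esub>" for i
    by (rule module_homs_zero[OF module_axioms module_axioms fi])
  show ?thesis
    unfolding independent_along_def
  proof (intro allI conjI ballI impI)
    fix i
    note fiD = module_homsD[OF fi[of i]]
    show "submodule ((f ^^ i) ` carrier M) R M"
    proof (rule submoduleI)
      show "(f ^^ i) ` carrier M \<subseteq> carrier M" using fiD by blast
      show "\<zero>\<^bsub>M\<^esub> \<in> (f ^^ i) ` carrier M" using f0[of i] by (metis M.zero_closed imageI)
      show smult: "a \<odot>\<^bsub>M\<^esub> v \<in> (f ^^ i) ` carrier M" if "a \<in> carrier R" "v \<in> (f ^^ i) ` carrier M" for a v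
        using that by (auto simp flip: fiD(2,3))
      show "\<ominus>\<^bsub>M\<^esub> v \<in> (f ^^ i) ` carrier M" if "v \<in> (f ^^ i) ` carrier M" for v
      proof -
        have "v \<in> carrier M" using that fiD by blast
        thus ?thesis using smult[OF _ that, of "\<ominus>\<^bsub>R\<^esub> \<one>\<^bsub>R\<^esub>"] by (simp add: smult_l_minus)
      qed
      show "v \<oplus>\<^bsub>M\<^esub> w \<in> (f ^^ i) ` carrier M"
        if "v \<in> (f ^^ i) ` carrier M" "w \<in> (f ^^ i) ` carrier M" for v w
        using that by (auto simp flip: fiD(2,3))
    qed
    show "(f ^^ Suc i) ` carrier M \<subseteq> (f ^^ i) ` carrier M"
      using module_homsD(1)[OF f] by (auto simp: funpow_swap1)
    show "(f ^^ i) x \<in> (f ^^ i) ` carrier M" using x by blast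
    show "p \<odot>\<^bsub>M\<^esub> (f ^^ i) x = \<zero>\<^bsub>M\<^esub>" if "p \<in> P" for p
      using fiD(3)[of p x] f0[of i] x that P by auto
    fix r assume r: "r \<in> carrier R" "r \<odot>\<^bsub>M\<^esub> (f ^^ i) x \<in> (f ^^ Suc i) ` carrier M"
    then obtain v where v: "v \<in> carrier M" "(f ^^ i) (r \<odot>\<^bsub>M\<^esub> x) = (f ^^ i) (f v)"
      using fiD(3)[of r x] x by (auto simp: funpow_swap1)
    hence "r \<odot>\<^bsub>M\<^esub> x = f v"
      using inj_onD[OF fi_inj] r x module_homsD(1)[OF f] by blast
    thus "r \<in> P" using indep r v by blast
  qed
qed

end

section \<open>Direct sums\<close>

text \<open>Only finitely many coordinates are nonzero, and the product of the scalars killing them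
  stays outside \<open>P\<close> by primality.\<close>

lemma direct_sum_torsion:
  assumes P: "primeideal P R" and M: "\<And>i. i \<in> I \<Longrightarrow> module R (M i)"
    and x: "x \<in> carrier (direct_sum I M)"
    and tors: "\<And>i. i \<in> I \<Longrightarrow> \<exists>s\<in>carrier R - P. s \<odot>\<^bsub>M i\<^esub> x i = \<zero>\<^bsub>M i\<^esub>"
  shows "\<exists>s\<in>carrier R - P. s \<odot>\<^bsub>direct_sum I M\<^esub> x = \<zero>\<^bsub>direct_sum I M\<^esub>"
proof -
  interpret P: primeideal P R by fact
  have xc: "x i \<in> carrier (M i)" if "i \<in> I" for i using x that by (auto simp: direct_sum_def)
  have "\<exists>s\<in>carrier R - P. \<forall>i\<in>J. s \<odot>\<^bsub>M i\<^esub> x i = \<zero>\<^bsub>M i\<^esub>" if "finite J" "J \<subseteq> I" for J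
    using that
  proof (induction J)
    case empty
    show ?case using P.one_not_mem by auto
  next
    case (insert j J)
    then obtain s where s: "s \<in> carrier R" "s \<notin> P" "\<And>i. i \<in> J \<Longrightarrow> s \<odot>\<^bsub>M i\<^esub> x i = \<zero>\<^bsub>M i\<^esub>"
      by auto
    have j: "j \<in> I" and J: "J \<subseteq> I" using insert.prems by auto
    obtain t where t: "t \<in> carrier R" "t \<notin> P" "t \<odot>\<^bsub>M j\<^esub> x j = \<zero>\<^bsub>M j\<^esub>"
      using tors[OF j] by auto
    have "(s \<otimes>\<^bsub>R\<^esub> t) \<odot>\<^bsub>M j\<^esub> x j = \<zero>\<^bsub>M j\<^esub>"
      using s t module.smult_assoc1[OF M[OF j] s(1) t(1) xc[OF j]] module.smult_r_null[OF M[OF j] s(1)]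
      by simp
    moreover have "(s \<otimes>\<^bsub>R\<^esub> t) \<odot>\<^bsub>M i\<^esub> x i = \<zero>\<^bsub>M i\<^esub>" if i: "i \<in> J" for i
    proof -
      have iI: "i \<in> I" using i J by blast
      show ?thesis
        using P.m_comm[OF s(1) t(1)] s(3)[OF i] module.smult_assoc1[OF M[OF iI] t(1) s(1) xc[OF iI]]
          module.smult_r_null[OF M[OF iI] t(1)] by simp
    qed
    moreover have "s \<otimes>\<^bsub>R\<^esub> t \<notin> P" using P.I_prime s t by blast
    ultimately show ?case using s t by (intro bexI[of _ "s \<otimes>\<^bsub>R\<^esub> t"]) auto
  qed
  from this[of "{i \<in> I. x i \<noteq> \<zero>\<^bsub>M i\<^esub>}"] x obtain s
    where s: "s \<in> carrier R" "s \<notin> P" "\<And>i. i \<in> I \<Longrightarrow> x i \<noteq> \<zero>\<^bsub>M i\<^esub> \<Longrightarrow> s \<odot>\<^bsub>M i\<^esub> x i = \<zero>\<^bsub>M i\<^esub>"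
    by (auto simp: direct_sum_def)
  have "s \<odot>\<^bsub>M i\<^esub> x i = \<zero>\<^bsub>M i\<^esub>" if "i \<in> I" for i
    using s(3)[OF that] module.smult_r_null[OF M[OF that] s(1)] by (cases "x i = \<zero>\<^bsub>M i\<^esub>") auto
  hence "s \<odot>\<^bsub>direct_sum I M\<^esub> x = \<zero>\<^bsub>direct_sum I M\<^esub>"
    by (auto simp: direct_sum_def fun_eq_iff)
  thus ?thesis using s by blast
qed

section \<open>Co-Hopfian modules\<close>

lemma co_HopfianD:
  assumes "co_Hopfian R M" "f \<in> module_homs R M M" "inj_on f (carrier M)"
  shows "f ` carrier M = carrier M"
  using assms by (auto simp: co_Hopfian_def module_isos_def bij_betw_def)

lemma co_HopfianI:
  assumes "\<And>f. f \<in> module_homs R M M \<Longrightarrow> inj_on f (carrier M) \<Longrightarrow> carrier M \<subseteq> f ` carrier M"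
  shows "co_Hopfian R M"
  unfolding co_Hopfian_def
proof (intro ballI impI)
  fix f assume f: "f \<in> module_homs R M M" "inj_on f (carrier M)"
  have "f ` carrier M = carrier M"
    using assms[OF f] module_homsD(1)[OF f(1)] by (intro equalityI image_subsetI)
  thus "f \<in> module_isos R M M" using f by (simp add: module_isos_def bij_betw_def)
qed

section \<open>Transport along isomorphisms\<close>

lemma module_homs_comp:
  assumes "f \<in> module_homs R M N" "g \<in> module_homs R N K"
  shows "g \<circ> f \<in> module_homs R M K"
  using assms by (auto simp: module_homs_def Pi_iff)

lemma module_isos_inv_into:
  assumes M: "module R M" and f: "f \<in> module_isos R M N"
  shows "inv_into (carrier M) f \<in> module_homs R N M"
proof -
  interpret M: module R M by fact
  let ?g = "inv_into (carrier M) f"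
  have hom: "f \<in> module_homs R M N" and inj: "inj_on f (carrier M)"
    and img: "f ` carrier M = carrier N"
    using f by (auto simp: module_isos_def bij_betw_def)
  have g: "?g y \<in> carrier M" "f (?g y) = y" if "y \<in> carrier N" for y
    using that img by (metis inv_into_into, metis f_inv_into_f)
  show ?thesis
    unfolding module_homs_def
  proof (intro CollectI conjI ballI Pi_I)
    show "?g y \<in> carrier M" if "y \<in> carrier N" for y using that by (rule g)
    show "?g (x \<oplus>\<^bsub>N\<^esub> y) = ?g x \<oplus>\<^bsub>M\<^esub> ?g y" if "x \<in> carrier N" "y \<in> carrier N" for x y
      using that g by (intro inv_into_f_eq[OF inj]) (simp_all add: module_homsD[OF hom])
    show "?g (r \<odot>\<^bsub>N\<^esub> x) = r \<odot>\<^bsub>M\<^esub> ?g x" if "r \<in> carrier R" "x \<in> carrier N" for r x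
      using that g by (intro inv_into_f_eq[OF inj]) (simp_all add: module_homsD[OF hom])
  qed
qed

text \<open>Conjugation by the isomorphism \<open>p\<close> turns an injective endomorphism of
  \<open>N\<close> into one of \<open>M\<close>, and surjectivity comes back the same way.\<close>

lemma co_Hopfian_isomorphic:
  assumes M: "module R M" and iso: "isomorphic_modules R M N" and co: "co_Hopfian R M"
  shows "co_Hopfian R N"
proof (rule co_HopfianI)
  fix f assume f: "f \<in> module_homs R N N" "inj_on f (carrier N)"
  obtain p where p: "p \<in> module_isos R M N" using iso unfolding isomorphic_modules_def by blast
  let ?q = "inv_into (carrier M) p"
  have hom: "p \<in> module_homs R M N" and inj: "inj_on p (carrier M)"
    and img: "p ` carrier M = carrier N"
    using p by (auto simp: module_isos_def bij_betw_def)
  have q: "?q \<in> module_homs R N M" by (rule module_isos_inv_into[OF M p])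
  have pq: "p (?q y) = y" if "y \<in> carrier N" for y using that img by (simp add: f_inv_into_f)
  have "inj_on (?q \<circ> (f \<circ> p)) (carrier M)"
    using inj f(2) img inj_on_inv_into[of "carrier N" p "carrier M"] module_homsD(1)[OF f(1)]
    by (intro comp_inj_on) (auto intro: inj_on_subset)
  from co_HopfianD[OF co module_homs_comp[OF module_homs_comp[OF hom f(1)] q] this]
  have surj: "(?q \<circ> (f \<circ> p)) ` carrier M = carrier M" .
  show "carrier N \<subseteq> f ` carrier N"
  proof
    fix y assume y: "y \<in> carrier N"
    then obtain x where x: "x \<in> carrier M" "?q y = ?q (f (p x))"
      using surj module_homsD(1)[OF q y] by auto
    have "y = p (?q y)" using pq[OF y] by (rule sym)
    also have "\<dots> = f (p x)"
      unfolding x(2) by (rule pq[OF module_homsD(1)[OF f(1) module_homsD(1)[OF hom x(1)]]])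
    finally have "y = f (p x)" .
    thus "y \<in> f ` carrier N" using module_homsD(1)[OF hom x(1)] by blast
  qed
qed

section \<open>Necessity of finite multiplicities\<close>

text \<open>An injective endomorphism of \<open>M i\<close>, extended by the identity on the other
  summands, is injective on the whole sum. A preimage of the vector with sole entry \<open>y\<close>
  at \<open>i\<close> then has as its \<open>i\<close>-th entry a preimage of
  \<open>y\<close>.\<close>

lemma co_Hopfian_direct_sum_component:
  assumes M: "\<And>j. j \<in> I \<Longrightarrow> module R (M j)" and i: "i \<in> I"
    and co: "co_Hopfian R (direct_sum I M)"
  shows "co_Hopfian R (M i)"
proof (rule co_HopfianI)
  fix g assume g: "g \<in> module_homs R (M i) (M i)" "inj_on g (carrier (M i))"
  let ?D = "direct_sum I M"
  have z: "\<zero>\<^bsub>M j\<^esub> \<in> carrier (M j)" if "j \<in> I" for j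
    using module.axioms(2)[OF M[OF that]] by (simp add: abelian_group_def abelian_monoid.zero_closed)
  define f where "f x = (\<lambda>j\<in>I. if j = i then g (x i) else x j)" for x
  have "f \<in> module_homs R ?D ?D"
    unfolding module_homs_def
  proof (intro CollectI conjI ballI Pi_I)
    fix x assume x: "x \<in> carrier ?D"
    have "finite {j \<in> I. f x j \<noteq> \<zero>\<^bsub>M j\<^esub>}"
      by (rule finite_subset[of _ "insert i {j \<in> I. x j \<noteq> \<zero>\<^bsub>M j\<^esub>}"])
         (use x in \<open>auto simp: direct_sum_def f_def split: if_splits\<close>)
    moreover have "f x \<in> (\<Pi>\<^sub>E j\<in>I. carrier (M j))"
      using x module_homsD(1)[OF g(1)] i by (auto simp: direct_sum_def f_def PiE_iff)
    ultimately show "f x \<in> carrier ?D" by (simp add: direct_sum_def)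
    show "f (x \<oplus>\<^bsub>?D\<^esub> y) = f x \<oplus>\<^bsub>?D\<^esub> f y" if "y \<in> carrier ?D" for y
      using x that i by (auto simp: direct_sum_def f_def fun_eq_iff PiE_iff module_homsD[OF g(1)])
  next
    fix r x assume "r \<in> carrier R" "x \<in> carrier ?D"
    thus "f (r \<odot>\<^bsub>?D\<^esub> x) = r \<odot>\<^bsub>?D\<^esub> f x"
      using i by (auto simp: direct_sum_def f_def fun_eq_iff PiE_iff module_homsD[OF g(1)])
  qed
  moreover have "inj_on f (carrier ?D)"
  proof (rule inj_onI)
    fix x y assume xy: "x \<in> carrier ?D" "y \<in> carrier ?D" "f x = f y"
    have "x j = y j" if j: "j \<in> I" for j
    proof (cases "j = i")
      case True
      thus ?thesis using fun_cong[OF xy(3), of i] i xy(1,2) inj_onD[OF g(2), of "x i" "y i"]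
        by (auto simp: f_def direct_sum_def)
    next
      case False
      thus ?thesis using fun_cong[OF xy(3), of j] j by (simp add: f_def)
    qed
    thus "x = y" using xy(1,2) by (intro extensionalityI[of _ I]) (auto simp: direct_sum_def PiE_iff)
  qed
  ultimately have surj: "f ` carrier ?D = carrier ?D" by (rule co_HopfianD[OF co])
  show "carrier (M i) \<subseteq> g ` carrier (M i)"
  proof
    fix y assume y: "y \<in> carrier (M i)"
    let ?d = "\<lambda>j\<in>I. if j = i then y else \<zero>\<^bsub>M j\<^esub>"
    have "finite {j \<in> I. ?d j \<noteq> \<zero>\<^bsub>M j\<^esub>}"
      by (rule finite_subset[of _ "{i}"]) auto
    hence "?d \<in> carrier ?D" using y z by (auto simp: direct_sum_def)
    then obtain x where x: "x \<in> carrier ?D" "?d = f x" using surj by blast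
    have "y = g (x i)" using fun_cong[OF x(2), of i] i by (simp add: f_def)
    thus "y \<in> g ` carrier (M i)" using x(1) i by (auto simp: direct_sum_def)
  qed
qed

text \<open>An infinite index set is in bijection with itself minus a point \<open>i\<close>.
  Shifting coordinates along this bijection is injective, but every image has entry 0 at
  \<open>i\<close>, so the vector with entry \<open>v\<close> there is missed.\<close>

lemma co_Hopfian_copies_imp_finite:
  assumes M: "module R M" and v: "v \<in> carrier M" "v \<noteq> \<zero>\<^bsub>M\<^esub>"
    and co: "co_Hopfian R (copies n M)"
  shows "finite (Field n)"
proof (rule ccontr)
  interpret M: module R M by fact
  assume inf: "infinite (Field n)"
  let ?I = "Field n"
  from inf obtain i where i: "i \<in> ?I" by (metis ex_in_conv finite.emptyI)
  obtain p' where "bij_betw p' ?I (?I - {i})" using infinite_imp_bij_betw[OF inf] by blast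
  hence "bij_betw (inv_into ?I p') (?I - {i}) ?I" by (rule bij_betw_inv_into)
  then obtain p where p: "bij_betw p (?I - {i}) ?I" by blast
  have pI: "p j \<in> ?I" if "j \<in> ?I" "j \<noteq> i" for j using p that by (auto simp: bij_betw_def)
  have co: "co_Hopfian R (direct_sum ?I (\<lambda>_. M))" using co by (simp add: copies_def)
  let ?D = "direct_sum ?I (\<lambda>_. M)"
  define f where "f x = (\<lambda>j\<in>?I. if j = i then \<zero>\<^bsub>M\<^esub> else x (p j))" for x
  have "f \<in> module_homs R ?D ?D"
    unfolding module_homs_def
  proof (intro CollectI conjI ballI Pi_I)
    fix x assume x: "x \<in> carrier ?D"
    \<comment> \<open>Finite support is preserved: \<open>p\<close> maps the support of
      \<open>f x\<close> injectively into that of \<open>x\<close>.\<close>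
    have "inj_on p {j \<in> ?I. f x j \<noteq> \<zero>\<^bsub>M\<^esub>}"
      using p by (rule inj_on_subset[OF bij_betw_imp_inj_on]) (auto simp: f_def)
    moreover have "finite (p ` {j \<in> ?I. f x j \<noteq> \<zero>\<^bsub>M\<^esub>})"
      by (rule finite_subset[of _ "{j \<in> ?I. x j \<noteq> \<zero>\<^bsub>M\<^esub>}"])
         (use x pI in \<open>auto simp: direct_sum_def f_def split: if_splits\<close>)
    ultimately have "finite {j \<in> ?I. f x j \<noteq> \<zero>\<^bsub>M\<^esub>}" using finite_image_iff by blast
    moreover have "f x \<in> (\<Pi>\<^sub>E j\<in>?I. carrier M)"
      using x pI by (auto simp: direct_sum_def f_def PiE_iff)
    ultimately show "f x \<in> carrier ?D" by (simp add: direct_sum_def)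
    show "f (x \<oplus>\<^bsub>?D\<^esub> y) = f x \<oplus>\<^bsub>?D\<^esub> f y" if "y \<in> carrier ?D" for y
      using pI by (auto simp: direct_sum_def f_def fun_eq_iff)
  next
    fix r x assume "r \<in> carrier R" "x \<in> carrier ?D"
    thus "f (r \<odot>\<^bsub>?D\<^esub> x) = r \<odot>\<^bsub>?D\<^esub> f x"
      using pI by (auto simp: direct_sum_def f_def fun_eq_iff)
  qed
  moreover have "inj_on f (carrier ?D)"
  proof (rule inj_onI)
    fix x y assume xy: "x \<in> carrier ?D" "y \<in> carrier ?D" "f x = f y"
    have "x k = y k" if "k \<in> ?I" for k
    proof -
      have "k \<in> p ` (?I - {i})" using p that by (simp add: bij_betw_def)
      then obtain j where j: "j \<in> ?I" "j \<noteq> i" "k = p j" by blast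
      show ?thesis using fun_cong[OF xy(3), of j] j by (simp add: f_def)
    qed
    thus "x = y" using xy(1,2) by (intro extensionalityI[of _ ?I]) (auto simp: direct_sum_def PiE_iff)
  qed
  ultimately have surj: "f ` carrier ?D = carrier ?D" by (rule co_HopfianD[OF co])
  let ?d = "\<lambda>j\<in>?I. if j = i then v else \<zero>\<^bsub>M\<^esub>"
  have "finite {j \<in> ?I. ?d j \<noteq> \<zero>\<^bsub>M\<^esub>}"
    by (rule finite_subset[of _ "{i}"]) auto
  hence "?d \<in> carrier ?D" using v by (auto simp: direct_sum_def)
  then obtain x where "x \<in> carrier ?D" "?d = f x" using surj by blast
  from fun_cong[OF this(2), of i] i have "v = \<zero>\<^bsub>M\<^esub>" by (simp add: f_def)
  thus False using v by blast
qed

section \<open>Sufficiency of finite multiplicities\<close>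

text \<open>The identity of \<open>E\<close> is extended along \<open>f\<close>. This goes through
  \<open>injective_module_extend\<close>, since the elements of \<open>E\<close> need not have the
  type of the ring elements.\<close>

lemma injective_module_retraction:
  assumes E: "injective_module R E" and f: "f \<in> module_homs R E E" "inj_on f (carrier E)"
  obtains h where "h \<in> module_homs R E E" "\<And>x. x \<in> carrier E \<Longrightarrow> h (f x) = x"
proof -
  have "module R E" using E by (simp add: injective_module_def)
  moreover have "id \<in> module_homs R E E" by (auto simp: module_homs_def)
  ultimately show ?thesis using injective_module_extend[OF E _ _ f, of id] that by auto
qed

lemma co_Hopfian_if_finite_multiplicities:
  fixes R :: "('a, 'r) ring_scheme"
    and E :: "('a, 'e, 'c) module_scheme"
    and H :: "'a set \<Rightarrow> ('a, 'h, 'd) module_scheme"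
    and n :: "'a set \<Rightarrow> 'i rel"
  assumes noeth: "noetherian_ring R" and E: "injective_module R E"
    and H: "\<And>Q. primeideal Q R \<Longrightarrow> essential_prime_extension R (H Q) Q (u Q)"
    and phi: "\<phi> \<in> module_isos R E (direct_sum {P. primeideal P R} (\<lambda>P. copies (n P) (H P)))"
    and fin: "\<And>P. primeideal P R \<Longrightarrow> finite (Field (n P))"
  shows "co_Hopfian R E"
proof (rule co_HopfianI)
  fix f assume f: "f \<in> module_homs R E E" "inj_on f (carrier E)"
  have mE: "module R E" using E by (simp add: injective_module_def)
  interpret E: module R E by fact
  let ?S = "{P. primeideal P R}"
  let ?C = "\<lambda>P. copies (n P) (H P)"
  let ?D = "direct_sum ?S ?C"
  have mH: "module R (H Q)" if "Q \<in> ?S" for Q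
    using H[of Q] that by (simp add: essential_prime_extension_def)
  have mC: "module R (?C Q)" if "Q \<in> ?S" for Q
    unfolding copies_def by (rule direct_sum_module[OF E.R.is_cring mH[OF that]])
  have mD: "module R ?D" by (rule direct_sum_module[OF E.R.is_cring mC])
  have phi_hom: "\<phi> \<in> module_homs R E ?D" and phi_inj: "inj_on \<phi> (carrier E)"
    using phi by (auto simp: module_isos_def bij_betw_def)
  obtain h where h: "h \<in> module_homs R E E" "\<And>x. x \<in> carrier E \<Longrightarrow> h (f x) = x"
    using injective_module_retraction[OF E f] by blast
  show "carrier E \<subseteq> f ` carrier E"
  proof (rule ccontr)
    assume "\<not> carrier E \<subseteq> f ` carrier E"
    then obtain e where e: "e \<in> carrier E" "e \<notin> f ` carrier E" by blast
    \<comment> \<open>This is \<open>e - f (h e)\<close>, the component of \<open>e\<close> in the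
      kernel of \<open>h\<close>; it is nonzero because \<open>e\<close> is outside the image of
      \<open>f\<close>. Writing the difference with the scalar -1 lets the laws for sums and
      multiples evaluate \<open>h c\<close>.\<close>
    define c where "c = e \<oplus>\<^bsub>E\<^esub> (\<ominus>\<^bsub>R\<^esub> \<one>\<^bsub>R\<^esub>) \<odot>\<^bsub>E\<^esub> f (h e)"
    have fhe: "h e \<in> carrier E" "f (h e) \<in> carrier E"
      using e module_homsD(1)[OF h(1)] module_homsD(1)[OF f(1)] by auto
    have c: "c \<in> carrier E" using e fhe by (simp add: c_def)
    have "h c = h e \<oplus>\<^bsub>E\<^esub> (\<ominus>\<^bsub>R\<^esub> \<one>\<^bsub>R\<^esub>) \<odot>\<^bsub>E\<^esub> h e"
      using e fhe by (simp add: c_def module_homsD[OF h(1)] h(2))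
    hence hc: "h c = \<zero>\<^bsub>E\<^esub>" using fhe by (simp add: E.smult_l_minus E.M.r_neg)
    have "c \<noteq> \<zero>\<^bsub>E\<^esub>"
    proof
      assume "c = \<zero>\<^bsub>E\<^esub>"
      hence "e = f (h e)"
        using e fhe E.M.minus_equality[of e "\<ominus>\<^bsub>E\<^esub> f (h e)"] by (simp add: c_def E.smult_l_minus)
      thus False using e fhe by blast
    qed
    then obtain a where a: "a \<in> carrier R" "primeideal (annihilator R E (a \<odot>\<^bsub>E\<^esub> c)) R"
      using E.associated_prime_exists[OF noeth c] by blast
    define x where "x = a \<odot>\<^bsub>E\<^esub> c"
    define P where "P = annihilator R E x"
    have P: "primeideal P R" using a by (simp add: P_def x_def)
    interpret P: essential_prime_extension R "H P" P "u P" by (rule H[OF P])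
    have x: "x \<in> carrier E" and hx: "h x = \<zero>\<^bsub>E\<^esub>"
      using a c hc by (simp_all add: x_def module_homsD[OF h(1)])
    have ind: "E.independent_along P (\<lambda>i. (f ^^ i) ` carrier E) (\<lambda>i. (f ^^ i) x)"
    proof (rule E.independent_along_iterates[OF f x])
      show "p \<odot>\<^bsub>E\<^esub> x = \<zero>\<^bsub>E\<^esub>" if "p \<in> P" for p using that by (simp add: P_def annihilator_iff)
      show "P \<subseteq> carrier R" by (auto simp: P_def annihilator_iff)
      fix r assume r: "r \<in> carrier R" "r \<odot>\<^bsub>E\<^esub> x \<in> f ` carrier E"
      then obtain w where w: "w \<in> carrier E" "r \<odot>\<^bsub>E\<^esub> x = f w" by blast
      \<comment> \<open>The image of \<open>f\<close> meets the kernel of \<open>h\<close> only in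
        0: applying \<open>h\<close> to \<open>r x = f w\<close> gives
        \<open>w = r (h x) = 0\<close>.\<close>
      have "w = h (r \<odot>\<^bsub>E\<^esub> x)" using w h(2) by simp
      also have "\<dots> = \<zero>\<^bsub>E\<^esub>" using r x hx by (simp add: module_homsD[OF h(1)])
      finally have "r \<odot>\<^bsub>E\<^esub> x = \<zero>\<^bsub>E\<^esub>" using w module_homs_zero[OF mE mE f(1)] by simp
      thus "r \<in> P" using r by (simp add: P_def annihilator_iff)
    qed
    have coord: "(\<lambda>x. \<phi> x P j) \<in> module_homs R E (H P)" if "j \<in> Field (n P)" for j
      using that P module_homsD(1)[OF phi_hom]
      by (auto simp: module_homs_def module_homsD(2,3)[OF phi_hom] direct_sum_def copies_def PiE_iff)
    have mHP: "module R (H P)" using mH P by simp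
    obtain z where z: "z \<in> carrier E" "annihilator R E z = P"
      and zj: "\<And>j. j \<in> Field (n P) \<Longrightarrow> \<phi> z P j = \<zero>\<^bsub>H P\<^esub>"
      by (rule E.eliminate_coordinates[where c = "\<lambda>j x. \<phi> x P j",
          OF P mHP fin[OF P] coord P.rank_one ind]) (rule that | blast)+
    have phiz: "\<phi> z \<in> carrier ?D" by (rule module_homsD(1)[OF phi_hom z(1)])
    have zQ: "\<phi> z Q \<in> carrier (?C Q)" if "Q \<in> ?S" for Q
      using phiz that by (simp add: direct_sum_def PiE_iff)
    have zQj: "\<phi> z Q j \<in> carrier (H Q)" if "Q \<in> ?S" "j \<in> Field (n Q)" for Q j
      using zQ[OF that(1)] that(2) by (simp add: copies_def direct_sum_def PiE_iff)
    \<comment> \<open>At \<open>Q = P\<close> the coordinates have been eliminated and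
      \<open>s = 1\<close> serves. For \<open>Q \<noteq> P\<close> the torsion lemma applies to
      \<open>H Q\<close>, with \<open>P\<close> as the prime that kills the coordinate.\<close>
    have "\<exists>s\<in>carrier R - P. s \<odot>\<^bsub>H Q\<^esub> \<phi> z Q j = \<zero>\<^bsub>H Q\<^esub>"
      if Q: "Q \<in> ?S" and j: "j \<in> Field (n Q)" for Q j
    proof (cases "Q = P")
      case True
      have "\<one>\<^bsub>R\<^esub> \<odot>\<^bsub>H Q\<^esub> \<phi> z Q j = \<zero>\<^bsub>H Q\<^esub>" using True zj j by simp
      thus ?thesis using P.P.one_not_mem by blast
    next
      case False
      interpret Q: essential_prime_extension R "H Q" Q "u Q" using H Q by simp
      show ?thesis
      proof (rule Q.other_prime_torsion[OF noeth P])
        show "P \<noteq> Q" using False by simp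
        show "\<phi> z Q j \<in> carrier (H Q)" by (rule zQj[OF Q j])
        fix p assume "p \<in> P"
        hence p: "p \<in> carrier R" "p \<odot>\<^bsub>E\<^esub> z = \<zero>\<^bsub>E\<^esub>" using z(2) annihilator_iff by metis+
        have "p \<odot>\<^bsub>H Q\<^esub> \<phi> z Q j = (p \<odot>\<^bsub>?D\<^esub> \<phi> z) Q j"
          using Q j by (simp add: direct_sum_def copies_def)
        also have "p \<odot>\<^bsub>?D\<^esub> \<phi> z = \<zero>\<^bsub>?D\<^esub>"
          using module_homsD(3)[OF phi_hom p(1) z(1)] p(2) module_homs_zero[OF mE mD phi_hom] by simp
        also have "\<zero>\<^bsub>?D\<^esub> Q j = \<zero>\<^bsub>H Q\<^esub>" using Q j by (simp add: direct_sum_def copies_def)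
        finally show "p \<odot>\<^bsub>H Q\<^esub> \<phi> z Q j = \<zero>\<^bsub>H Q\<^esub>" .
      qed
    qed
    \<comment> \<open>The sum has two layers, so torsion is collected twice: over the copies of
      \<open>H Q\<close> for fixed \<open>Q\<close>, then over all primes \<open>Q\<close>.\<close>
    hence "\<exists>s\<in>carrier R - P. s \<odot>\<^bsub>?C Q\<^esub> \<phi> z Q = \<zero>\<^bsub>?C Q\<^esub>" if "Q \<in> ?S" for Q
      unfolding copies_def
      using that by (intro direct_sum_torsion[OF P mH[OF that] zQ[OF that, unfolded copies_def]])
    hence "\<exists>s\<in>carrier R - P. s \<odot>\<^bsub>?D\<^esub> \<phi> z = \<zero>\<^bsub>?D\<^esub>"
      by (intro direct_sum_torsion[OF P mC phiz])
    then obtain s where s: "s \<in> carrier R" "s \<notin> P" "s \<odot>\<^bsub>?D\<^esub> \<phi> z = \<zero>\<^bsub>?D\<^esub>" by blast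
    have "\<phi> (s \<odot>\<^bsub>E\<^esub> z) = \<phi> \<zero>\<^bsub>E\<^esub>"
      using module_homsD(3)[OF phi_hom s(1) z(1)] s(3) module_homs_zero[OF mE mD phi_hom] by simp
    hence "s \<odot>\<^bsub>E\<^esub> z = \<zero>\<^bsub>E\<^esub>" using inj_onD[OF phi_inj] s(1) z(1) by blast
    hence "s \<in> annihilator R E z" using s(1) by (simp add: annihilator_iff)
    thus False using s(2) z(2) by simp
  qed
qed

theorem theorem2p1:
  fixes R :: "('a, 'r) ring_scheme"
    and E :: "('a, 'e, 'c) module_scheme"
    and H :: "'a set \<Rightarrow> ('a, 'h, 'd) module_scheme"
    and n :: "'a set \<Rightarrow> 'i rel"
  assumes "cring R" and "noetherian_ring R" and "\<one>\<^bsub>R\<^esub> \<noteq> \<zero>\<^bsub>R\<^esub>"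
    and "injective_module R E"
    and "\<And>P. primeideal P R \<Longrightarrow> injective_envelope R (quotient_module R P) (H P)"
    and "\<And>P. primeideal P R \<Longrightarrow> Card_order (n P)"
    and "isomorphic_modules R E (direct_sum {P. primeideal P R} (\<lambda>P. copies (n P) (H P)))"
  shows "co_Hopfian R E \<longleftrightarrow> (\<forall>P. primeideal P R \<longrightarrow> finite (Field (n P)))"
proof -
  have "\<exists>u. essential_prime_extension R (H P) P u" if "primeideal P R" for P
    using injective_envelope_essential_prime_extension[OF that assms(5)[OF that]] by blast
  then obtain u where u: "\<And>P. primeideal P R \<Longrightarrow> essential_prime_extension R (H P) P (u P)"
    by metis
  have mE: "module R E" using assms(4) by (simp add: injective_module_def)
  have mH: "module R (H P)" if "primeideal P R" for P
    using u[OF that] by (simp add: essential_prime_extension_def)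
  have "finite (Field (n P))" if co: "co_Hopfian R E" and P: "primeideal P R" for P
  proof -
    interpret P: essential_prime_extension R "H P" P "u P" by (rule u[OF P])
    \<comment> \<open>The property passes from \<open>E\<close> to the isomorphic direct sum and
      from there to its summand at \<open>P\<close>; \<open>u P\<close> then supplies the nonzero
      vector for the shift argument.\<close>
    have "co_Hopfian R (copies (n P) (H P))"
      by (rule co_Hopfian_direct_sum_component[OF _ _ co_Hopfian_isomorphic[OF mE assms(7) co]])
         (use P mH in \<open>auto simp: copies_def intro: direct_sum_module[OF assms(1)]\<close>)
    thus ?thesis by (rule co_Hopfian_copies_imp_finite[OF mH[OF P] P.u_closed P.u_nonzero])
  qed
  moreover have "co_Hopfian R E" if "\<And>P. primeideal P R \<Longrightarrow> finite (Field (n P))"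
    using co_Hopfian_if_finite_multiplicities[OF assms(2,4) u] assms(7) that
    unfolding isomorphic_modules_def by blast
  ultimately show ?thesis by blast
qed

end
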